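(* Let $d\ge2$ and assume $k(\alpha)>0$ for all $\alpha\in R$ (with $R$ nonempty, so $\gamma>0$). For every function $h\in C(\mathbb{R}^d)$ and every $t>0$, $$\int_{S^{d-1}}V_k(h)(t\xi)\,\omega_k(\xi)\,d\sigma(\xi)=\frac{\Gamma(\gamma+\frac d2)\,d_k}{\pi^{d/2}\,\Gamma(\gamma)}\,t^{2-2\gamma-d}\int_{B(0,t)}h(y)\,(t^2-\|y\|^2)^{\gamma-1}\,dy,$$ where $B(0,t)$ is the open ball of center $0$ and radius $t$.
   Context: $\langle\cdot,\cdot\rangle$ is the Euclidean scalar product on $\mathbb{R}^d$ and $\|\cdot\|$ its norm. For $\alpha\in\mathbb{R}^d\setminus\{0\}$, $\sigma_\alpha(x)=x-2\frac{\langle\alpha,x\rangle}{\|\alpha\|^2}\alpha$ is the reflection in the hyperplane $H_\alpha=\alpha^{\perp}$. $R\subset\mathbb{R}^d\setminus\{0\}$ is a root system: a finite set with $R\cap\mathbb{R}\alpha=\{\pm\alpha\}$ and $\sigma_\alpha R=R$ for all $\alpha\in R$, normalized by $\|\alpha\|^2=2$. $W$ is the finite group generated by the $\sigma_\alpha$, $\alpha\in R$; $R_+=\{\alpha\in R:\langle\alpha,\beta\rangle>0\}$ for a fixed $\beta\in\mathbb{R}^d\setminus\bigcup_{\alpha\in R}H_\alpha$. $k:R\to[0,\infty)$ is $W$-invariant, $\gamma=\sum_{\alpha\in R_+}k(\alpha)$, $\omega_k(x)=\prod_{\alpha\in R_+}|\langle\alpha,x\rangle|^{2k(\alpha)}$.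 $d\sigma$ is the surface measure on the unit sphere $S^{d-1}$ and $d_k=\int_{S^{d-1}}\omega_k(\beta)\,d\sigma(\beta)$. The Dunkl operators are $T_jf(x)=\frac{\partial f}{\partial x_j}(x)+\sum_{\alpha\in R_+}k(\alpha)\alpha_j\frac{f(x)-f(\sigma_\alpha(x))}{\langle\alpha,x\rangle}$, $j=1,\dots,d$. The Dunkl intertwining operator $V_k$ is the unique linear operator on polynomials that maps the homogeneous polynomials of degree $n$ onto themselves for each $n$, with $V_k(1)=1$ and $T_jV_k=V_k\frac{\partial}{\partial x_j}$ for all $j$. For every $x\in\mathbb{R}^d$ there is a unique probability measure $\mu_x$ supported in the closed ball of center $0$ and radius $\|x\|$ with $V_kp(x)=\int p\,d\mu_x$ for all polynomials $p$; $V_k$ is extended to $C(\mathbb{R}^d)$ (continuous functions) by $V_kf(x)=\int_{\mathbb{R}^d}f(y)\,d\mu_x(y)$. *)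

theory Defs
  imports "HOL-Analysis.Analysis" "HOL-Probability.Probability_Measure"
begin

section \<open>Root systems and multiplicity functions\<close>

definition reflection :: "real^'n \<Rightarrow> real^'n \<Rightarrow> real^'n" where
  "reflection \<alpha> x = x - (2 * (\<alpha> \<bullet> x) / (norm \<alpha>)\<^sup>2) *\<^sub>R \<alpha>"

definition normalized_root_system :: "(real^'n) set \<Rightarrow> bool" where
  "normalized_root_system R \<longleftrightarrow>
     finite R \<and> 0 \<notin> R \<and>
     (\<forall>\<alpha>\<in>R. R \<inter> range (\<lambda>c. c *\<^sub>R \<alpha>) = {\<alpha>, - \<alpha>} \<and> reflection \<alpha> ` R = R \<and> (norm \<alpha>)\<^sup>2 = 2)"

text \<open>Reflections are involutions, so closure under composition with the generators already
  yields the generated group.\<close>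
inductive_set reflection_group :: "(real^'n) set \<Rightarrow> (real^'n \<Rightarrow> real^'n) set"
  for R :: "(real^'n) set" where
  id: "id \<in> reflection_group R"
| step: "\<alpha> \<in> R \<Longrightarrow> w \<in> reflection_group R \<Longrightarrow> reflection \<alpha> \<circ> w \<in> reflection_group R"

definition multiplicity_invariant :: "(real^'n) set \<Rightarrow> (real^'n \<Rightarrow> real) \<Rightarrow> bool" where
  "multiplicity_invariant R k \<longleftrightarrow> (\<forall>w\<in>reflection_group R. \<forall>\<alpha>\<in>R. k (w \<alpha>) = k \<alpha>)"

definition regular_vector :: "(real^'n) set \<Rightarrow> real^'n \<Rightarrow> bool" where
  "regular_vector R \<beta> \<longleftrightarrow> (\<forall>\<alpha>\<in>R. \<alpha> \<bullet> \<beta> \<noteq> 0)"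

definition positive_roots :: "(real^'n) set \<Rightarrow> real^'n \<Rightarrow> (real^'n) set" where
  "positive_roots R \<beta> = {\<alpha>\<in>R. \<alpha> \<bullet> \<beta> > 0}"

text \<open>In the definitions below \<open>P\<close> stands for the positive system \<open>positive_roots R \<beta>\<close>.\<close>

definition dunkl_gamma :: "(real^'n) set \<Rightarrow> (real^'n \<Rightarrow> real) \<Rightarrow> real" where
  "dunkl_gamma P k = (\<Sum>\<alpha>\<in>P. k \<alpha>)"

text \<open>Since \<open>0 powr 0 = 0\<close>, at a root with \<open>k \<alpha> = 0\<close> this differs from the usual
  convention on the hyperplane orthogonal to \<open>\<alpha>\<close>; for \<open>k > 0\<close> there is no difference.\<close>
definition dunkl_weight :: "(real^'n) set \<Rightarrow> (real^'n \<Rightarrow> real) \<Rightarrow> real^'n \<Rightarrow> real" where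
  "dunkl_weight P k x = (\<Prod>\<alpha>\<in>P. \<bar>\<alpha> \<bullet> x\<bar> powr (2 * k \<alpha>))"

section \<open>Surface measure on the unit sphere\<close>

text \<open>The sphere measure of \<open>A\<close> is \<open>d\<close> times the Lebesgue measure of the part of the open
  unit ball lying in the cone over \<open>A\<close>, as in integration in polar coordinates.\<close>
definition surface_measure :: "(real^'n) measure" where
  "surface_measure =
     scale_measure (of_nat CARD('n))
       (distr (restrict_space lborel (ball 0 1 - {0})) (restrict_space borel (sphere 0 1))
          (\<lambda>x. x /\<^sub>R norm x))"

definition dunkl_sphere_mass :: "(real^'n) set \<Rightarrow> (real^'n \<Rightarrow> real) \<Rightarrow> real" where
  "dunkl_sphere_mass P k = (\<integral>\<xi>. dunkl_weight P k \<xi> \<partial>surface_measure)"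

section \<open>Dunkl operators and the intertwining operator\<close>

definition partial_deriv :: "'n \<Rightarrow> (real^'n \<Rightarrow> real) \<Rightarrow> real^'n \<Rightarrow> real" where
  "partial_deriv j f x = deriv (\<lambda>s. f (x + s *\<^sub>R axis j 1)) 0"

text \<open>On the hyperplane orthogonal to \<open>\<alpha>\<close> the quotient in the Dunkl operator is understood as
  its continuous extension, which exists whenever \<open>f\<close> is continuously differentiable.\<close>
definition reflection_quotient :: "real^'n \<Rightarrow> (real^'n \<Rightarrow> real) \<Rightarrow> real^'n \<Rightarrow> real" where
  "reflection_quotient \<alpha> f x =
     (if \<alpha> \<bullet> x \<noteq> 0 then (f x - f (reflection \<alpha> x)) / (\<alpha> \<bullet> x)
      else Lim (at x within {y. \<alpha> \<bullet> y \<noteq> 0}) (\<lambda>y. (f y - f (reflection \<alpha> y)) / (\<alpha> \<bullet> y)))"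

definition dunkl_operator ::
  "(real^'n) set \<Rightarrow> (real^'n \<Rightarrow> real) \<Rightarrow> 'n \<Rightarrow> (real^'n \<Rightarrow> real) \<Rightarrow> real^'n \<Rightarrow> real" where
  "dunkl_operator P k j f x =
     partial_deriv j f x + (\<Sum>\<alpha>\<in>P. k \<alpha> * \<alpha> $ j * reflection_quotient \<alpha> f x)"

definition homogeneous_polynomials :: "nat \<Rightarrow> (real^'n \<Rightarrow> real) set" where
  "homogeneous_polynomials n =
     {p. real_polynomial_function p \<and> (\<forall>c x. p (c *\<^sub>R x) = c ^ n * p x)}"

text \<open>Only the values of \<open>V\<close> on polynomial functions are constrained.\<close>
definition dunkl_intertwining ::
  "(real^'n) set \<Rightarrow> (real^'n \<Rightarrow> real) \<Rightarrow> ((real^'n \<Rightarrow> real) \<Rightarrow> (real^'n \<Rightarrow> real)) \<Rightarrow> bool" where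
  "dunkl_intertwining P k V \<longleftrightarrow>
     (\<forall>p q. real_polynomial_function p \<longrightarrow> real_polynomial_function q \<longrightarrow>
        V (\<lambda>x. p x + q x) = (\<lambda>x. V p x + V q x)) \<and>
     (\<forall>c p. real_polynomial_function p \<longrightarrow> V (\<lambda>x. c * p x) = (\<lambda>x. c * V p x)) \<and>
     (\<forall>n. V ` homogeneous_polynomials n = homogeneous_polynomials n) \<and>
     V (\<lambda>x. 1) = (\<lambda>x. 1) \<and>
     (\<forall>j p. real_polynomial_function p \<longrightarrow>
        dunkl_operator P k j (V p) = V (partial_deriv j p))"

definition represents_intertwining ::
  "((real^'n \<Rightarrow> real) \<Rightarrow> (real^'n \<Rightarrow> real)) \<Rightarrow> (real^'n \<Rightarrow> (real^'n) measure) \<Rightarrow> bool" where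
  "represents_intertwining V \<mu> \<longleftrightarrow>
     (\<forall>x. prob_space (\<mu> x) \<and> sets (\<mu> x) = sets borel \<and>
          emeasure (\<mu> x) (- cball 0 (norm x)) = 0 \<and>
          (\<forall>p. real_polynomial_function p \<longrightarrow> V p x = (\<integral>y. p y \<partial>\<mu> x)))"

text \<open>The extension of the intertwining operator to continuous functions.\<close>
definition intertwining_extension ::
  "(real^'n \<Rightarrow> (real^'n) measure) \<Rightarrow> (real^'n \<Rightarrow> real) \<Rightarrow> real^'n \<Rightarrow> real" where
  "intertwining_extension \<mu> f x = (\<integral>y. f y \<partial>\<mu> x)"

end

theory Submission
  imports Defs
begin

text \<open>For a polynomial $h$, both sides of the formula are determined by the way they react to the Laplacian.
Write $L(p) = \int_{S^{d-1}} V_k p\,\omega_k\,d\sigma$.  The Dunkl Laplacian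
$\Delta_k = \sum_j T_j^2$ satisfies $\Delta_k V_k = V_k \Delta$, and a homogeneous polynomial $q$ of
degree $n \ge 1$ satisfies
$\int_{S^{d-1}} \Delta_k q\,\omega_k\,d\sigma = n (n + d - 2 + 2\gamma) \int_{S^{d-1}} q\,\omega_k\,d\sigma$.
Hence $L(\Delta p) = n (n + d - 2 + 2\gamma) L(p)$ for $p$ homogeneous of degree $n$
(\<open>sphere_integral_laplacian\<close>).  With no roots at all the same statement says that the plain mean
$L_0(p) = \int_{S^{d-1}} p\,d\sigma$ satisfies $L_0(\Delta p) = n (n + d - 2) L_0(p)$.  The quotient of the
two eigenvalues is the quotient of two consecutive values of a beta function, so induction on the degree
gives $L(p) = K\,\frac12 B(\frac{n+d}2, \gamma)\,L_0(p)$ (\<open>intertwining_sphere_integral\<close>), where $K$ is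
the constant of the formula.  In polar coordinates $\frac12 B(\frac{n+d}2, \gamma)\,L_0(p)$ is
$\int_{|y| < 1} p(y) (1 - |y|^2)^{\gamma - 1}\,dy$ (\<open>homogeneous_ball_integral\<close>).  This is the theorem for
homogeneous polynomials and $t = 1$; scaling, linearity and the Weierstrass approximation theorem do the rest,
since $V_k$ does not increase the supremum over a ball centred at $0$.

The eigenvalue identity on the sphere comes from an integration by parts on the unit ball.  Let
$b(x) = \max(0, 1 - |x|^2)$.  Its square is $C^1$, vanishes outside the ball and is invariant under
the reflections, and $\partial_j b^2 = -4 x_j b$, so that
$\int T_j q\; b^2 \omega_k\,dx = 4 \int x_j q\, b\, \omega_k\,dx$ (\<open>dunkl_integration_by_parts\<close>).
Applying this to $T_j q$ and summing over $j$ gives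
$\int \Delta_k q\; b^2 \omega_k\,dx = 4 \int \sum_j x_j T_j q\; b\,\omega_k\,dx$.  By Euler's identity
$\sum_j x_j T_j q = n q + \sum_\alpha k(\alpha) (q - q \circ \sigma_\alpha)$, and the difference terms
integrate to $0$ because $b\,\omega_k$ is invariant (\<open>dunkl_intertwining_green\<close>).  Since both
integrands are homogeneous up to a radial factor, polar coordinates turn the ball integrals into sphere
integrals with beta function factors.

The weight $\omega_k$ need not be differentiable on the reflecting hyperplanes.  The integration by parts is
therefore done first for the smooth weights
$\prod_\alpha (\langle\alpha,x\rangle^2 + \epsilon)^{k(\alpha)}$, which are just as invariant.  Their
logarithmic derivative is odd under $\sigma_\alpha$ in the term of the root $\alpha$, so $q$ may be
replaced there by half of $q - q \circ \sigma_\alpha$.  This difference is divisible by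
$\langle\alpha,x\rangle$ with a continuous quotient (\<open>reflection_divided_difference\<close>), everything stays
bounded as $\epsilon \to 0$, and dominated convergence applies.\<close>

section \<open>Polynomial functions and homogeneity\<close>

lemma real_polynomial_function_directional_derivative:
  assumes "real_polynomial_function p"
  shows "\<exists>p'. real_polynomial_function p' \<and>
    (\<forall>x. ((\<lambda>s. p (x + s *\<^sub>R e)) has_real_derivative p' x) (at 0))"
  using assms
proof (induction p)
  case (linear f)
  have "((\<lambda>s. f (x + s *\<^sub>R e)) has_real_derivative f e) (at 0)" for x
  proof -
    have "(\<lambda>s. f (x + s *\<^sub>R e)) = (\<lambda>s. f x + s * f e)"
      using linear by (auto simp: linear_simps)
    then show ?thesis by (auto intro!: derivative_eq_intros)
  qed
  then show ?case by blast
next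
  case (const c)
  have "((\<lambda>s. c) has_real_derivative 0) (at 0)" by simp
  then show ?case by blast
next
  case (add f g)
  then obtain f' g' where "real_polynomial_function f'" "real_polynomial_function g'"
    "\<And>x. ((\<lambda>s. f (x + s *\<^sub>R e)) has_real_derivative f' x) (at 0)"
    "\<And>x. ((\<lambda>s. g (x + s *\<^sub>R e)) has_real_derivative g' x) (at 0)" by blast
  then show ?case
    by (intro exI[of _ "\<lambda>x. f' x + g' x"]) (auto intro!: derivative_eq_intros)
next
  case (mult f g)
  then obtain f' g' where *: "real_polynomial_function f'" "real_polynomial_function g'"
    "\<And>x. ((\<lambda>s. f (x + s *\<^sub>R e)) has_real_derivative f' x) (at 0)"
    "\<And>x. ((\<lambda>s. g (x + s *\<^sub>R e)) has_real_derivative g' x) (at 0)" by blast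
  have "((\<lambda>s. f (x + s *\<^sub>R e) * g (x + s *\<^sub>R e)) has_real_derivative f' x * g x + g' x * f x) (at 0)"
    for x using DERIV_mult[OF *(3)[of x] *(4)[of x]] by simp
  then show ?case
    using * mult by (intro exI[of _ "\<lambda>x. f' x * g x + g' x * f x"]) auto
qed

lemma
  fixes p :: "real^'n \<Rightarrow> real"
  assumes "real_polynomial_function p"
  shows real_polynomial_function_partial_deriv:
      "real_polynomial_function (partial_deriv j p)"
    and partial_deriv_polynomial_at_0:
      "((\<lambda>s. p (x + s *\<^sub>R axis j 1)) has_real_derivative partial_deriv j p x) (at 0)"
proof -
  obtain p' where p': "real_polynomial_function p'"
    "\<And>x. ((\<lambda>s. p (x + s *\<^sub>R axis j 1)) has_real_derivative p' x) (at 0)"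
    using real_polynomial_function_directional_derivative[OF assms] by blast
  have "partial_deriv j p = p'"
    using p'(2) by (auto simp: partial_deriv_def DERIV_imp_deriv)
  with p' show "real_polynomial_function (partial_deriv j p)"
    "((\<lambda>s. p (x + s *\<^sub>R axis j 1)) has_real_derivative partial_deriv j p x) (at 0)" by auto
qed

lemma partial_deriv_unique:
  "((\<lambda>s. p (x + s *\<^sub>R axis j 1)) has_real_derivative d) (at 0) \<Longrightarrow> partial_deriv j p x = d"
  by (simp add: partial_deriv_def DERIV_imp_deriv)

lemma continuous_on_real_polynomial_function:
  "real_polynomial_function p \<Longrightarrow> continuous_on S p"
  by (simp add: differentiable_on_real_polynomial_function differentiable_imp_continuous_on)

text \<open>Both sides are the derivative of $s \mapsto p((1 + s) x)$ at $0$: the left one by linearity of the total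
derivative, the right one by homogeneity.\<close>

lemma homogeneous_euler_identity:
  fixes p :: "real^'n \<Rightarrow> real"
  assumes "p \<in> homogeneous_polynomials n"
  shows "(\<Sum>j\<in>UNIV. x $ j * partial_deriv j p x) = real n * p x"
proof -
  have rp: "real_polynomial_function p" and h: "\<And>c x. p (c *\<^sub>R x) = c ^ n * p x"
    using assms by (auto simp: homogeneous_polynomials_def)
  obtain D where D: "(p has_derivative D) (at x)"
    using differentiable_at_real_polynomial_function[OF rp, of x UNIV]
    by (auto simp: differentiable_def)
  interpret D: linear D using has_derivative_linear[OF D] .
  have line: "((\<lambda>s. p (x + s *\<^sub>R v)) has_real_derivative D v) (at 0)" for v
  proof -
    have "((\<lambda>s. p (x + s *\<^sub>R v)) has_derivative (\<lambda>s. D (s *\<^sub>R v))) (at 0)"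
      by (rule has_derivative_compose[of "\<lambda>s. x + s *\<^sub>R v" "\<lambda>s. s *\<^sub>R v" 0 UNIV p D, simplified])
         (auto intro!: derivative_eq_intros D)
    then show ?thesis
      by (simp add: has_field_derivative_def D.scale mult_commute_abs)
  qed
  have "D x = D (\<Sum>j\<in>UNIV. (x $ j) *\<^sub>R axis j 1)"
    using basis_expansion[of x] by (simp add: scalar_mult_eq_scaleR)
  also have "\<dots> = (\<Sum>j\<in>UNIV. x $ j * D (axis j 1))"
    by (simp add: D.sum D.scale)
  also have "\<dots> = (\<Sum>j\<in>UNIV. x $ j * partial_deriv j p x)"
    using partial_deriv_unique[OF line] by simp
  finally have 1: "D x = (\<Sum>j\<in>UNIV. x $ j * partial_deriv j p x)" .
  have "(\<lambda>s. p (x + s *\<^sub>R x)) = (\<lambda>s. (1 + s) ^ n * p x)"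
    using h[of "1 + _" x] by (auto simp: scaleR_add_left)
  moreover have "((\<lambda>s. (1 + s) ^ n * p x) has_real_derivative real n * p x) (at 0)"
    by (auto intro!: derivative_eq_intros)
  ultimately have "D x = real n * p x"
    using line[of x] by (metis DERIV_unique)
  with 1 show ?thesis by simp
qed

lemma homogeneous_0_const:
  assumes "p \<in> homogeneous_polynomials 0"
  shows "p = (\<lambda>_. p 0)"
proof
  fix x
  have "p (0 *\<^sub>R x) = 0 ^ 0 * p x"
    using assms unfolding homogeneous_polynomials_def by blast
  then show "p x = p 0" by simp
qed

lemma partial_deriv_homogeneous_0:
  assumes "p \<in> homogeneous_polynomials 0"
  shows "partial_deriv j p = (\<lambda>_. 0)"
proof -
  have "partial_deriv j (\<lambda>_. p 0) = (\<lambda>_. 0)"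
    by (auto simp: partial_deriv_def)
  then show ?thesis using homogeneous_0_const[OF assms] by simp
qed

text \<open>Differentiating $p(c x) = c^n p(x)$ gives $c\,\partial_j p(c x) = c^n \partial_j p(x)$, which settles
$c \neq 0$; continuity in $c$ gives $c = 0$.  In degree $0$ the derivative is zero, which is homogeneous of
every degree, so the truncated difference $n - 1$ is correct there too.\<close>

lemma homogeneous_partial_deriv:
  fixes p :: "real^'n \<Rightarrow> real"
  assumes "p \<in> homogeneous_polynomials n"
  shows "partial_deriv j p \<in> homogeneous_polynomials (n - 1)"
proof (cases n)
  case 0
  then show ?thesis
    using partial_deriv_homogeneous_0[of p] assms by (auto simp: homogeneous_polynomials_def)
next
  case (Suc m)
  have rp: "real_polynomial_function p" and h: "\<And>c x. p (c *\<^sub>R x) = c ^ n * p x"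
    using assms by (auto simp: homogeneous_polynomials_def)
  let ?d = "partial_deriv j p"
  have rd: "real_polynomial_function ?d"
    by (rule real_polynomial_function_partial_deriv[OF rp])
  have nz: "?d (c *\<^sub>R x) = c ^ m * ?d x" if "c \<noteq> 0" for c x
  proof -
    have "((\<lambda>s. p (c *\<^sub>R x + (c * s) *\<^sub>R axis j 1)) has_real_derivative ?d (c *\<^sub>R x) * c) (at 0)"
      by (rule DERIV_chain2[where f = "\<lambda>s. p (c *\<^sub>R x + s *\<^sub>R axis j 1)" and g = "\<lambda>s. c * s"])
         (auto intro!: derivative_eq_intros partial_deriv_polynomial_at_0 rp)
    moreover have "(\<lambda>s. p (c *\<^sub>R x + (c * s) *\<^sub>R axis j 1)) =
        (\<lambda>s. c ^ n * p (x + s *\<^sub>R axis j 1))"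
      using h[of c "x + _ *\<^sub>R axis j 1"] by (auto simp: scaleR_add_right)
    moreover have "((\<lambda>s. c ^ n * p (x + s *\<^sub>R axis j 1)) has_real_derivative c ^ n * ?d x) (at 0)"
      by (intro DERIV_cmult partial_deriv_polynomial_at_0 rp)
    ultimately have "?d (c *\<^sub>R x) * c = c ^ n * ?d x"
      by (metis DERIV_unique)
    then show ?thesis using that Suc by simp
  qed
  have z: "?d (c *\<^sub>R x) = c ^ m * ?d x" for c x
  proof (cases "c = 0")
    case True
    have cd: "continuous_on UNIV ?d" by (rule continuous_on_real_polynomial_function[OF rd])
    have "((\<lambda>c. ?d (c *\<^sub>R x)) \<longlongrightarrow> ?d (0 *\<^sub>R x)) (at 0)"
    proof -
      have "continuous_on UNIV (\<lambda>c. ?d (c *\<^sub>R x))"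
        by (rule continuous_on_compose2[OF cd]) (auto intro!: continuous_intros)
      then show ?thesis by (metis UNIV_I continuous_on_def)
    qed
    moreover have "((\<lambda>c. c ^ m * ?d x) \<longlongrightarrow> 0 ^ m * ?d x) (at 0)"
      by (intro tendsto_intros)
    moreover have "\<forall>\<^sub>F c in at 0. ?d (c *\<^sub>R x) = c ^ m * ?d x"
      using nz by (auto simp: eventually_at_filter)
    ultimately have "?d (0 *\<^sub>R x) = 0 ^ m * ?d x"
      using tendsto_cong[of "\<lambda>c. ?d (c *\<^sub>R x)" "\<lambda>c. c ^ m * ?d x" "at 0"]
        tendsto_unique[of "at (0::real)"] by auto
    with True show ?thesis by simp
  qed (use nz in auto)
  with rd Suc show ?thesis by (auto simp: homogeneous_polynomials_def)
qed

text \<open>The additive span of the homogeneous polynomials, given inductively so that additive statements about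
polynomials need only be checked on homogeneous ones and on sums of two terms.\<close>

inductive_set homogeneous_sums :: "(real^'n \<Rightarrow> real) set" where
  base: "p \<in> homogeneous_polynomials n \<Longrightarrow> p \<in> homogeneous_sums"
| add: "p \<in> homogeneous_sums \<Longrightarrow> q \<in> homogeneous_sums \<Longrightarrow> (\<lambda>x. p x + q x) \<in> homogeneous_sums"

lemma homogeneous_sums_polynomial:
  "p \<in> homogeneous_sums \<Longrightarrow> real_polynomial_function p"
  by (induction rule: homogeneous_sums.induct) (auto simp: homogeneous_polynomials_def)

lemma homogeneous_sums_mult:
  assumes "p \<in> homogeneous_sums" "q \<in> homogeneous_sums"
  shows "(\<lambda>x. p x * q x) \<in> homogeneous_sums"
  using assms(1)
proof induction
  case (base p n)
  show ?case
    using assms(2)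
  proof induction
    case (base q m)
    with \<open>p \<in> homogeneous_polynomials n\<close>
    have "(\<lambda>x. p x * q x) \<in> homogeneous_polynomials (n + m)"
      by (auto simp: homogeneous_polynomials_def power_add)
    then show ?case by (rule homogeneous_sums.base)
  next
    case (add q r)
    then show ?case by (auto simp: distrib_left intro: homogeneous_sums.add)
  qed
next
  case (add p r)
  then show ?case by (auto simp: distrib_right intro: homogeneous_sums.add)
qed

lemma polynomial_in_homogeneous_sums:
  assumes "real_polynomial_function p"
  shows "p \<in> homogeneous_sums"
  using assms
proof induction
  case (linear f)
  then have "f \<in> homogeneous_polynomials 1"
    by (auto simp: homogeneous_polynomials_def linear_simps)
  then show ?case by (rule homogeneous_sums.base)
next
  case (const c)
  have "(\<lambda>x. c) \<in> homogeneous_polynomials 0"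
    by (auto simp: homogeneous_polynomials_def)
  then show ?case by (rule homogeneous_sums.base)
qed (auto intro: homogeneous_sums.add homogeneous_sums_mult)

lemma bounded_linear_reflection: "bounded_linear (reflection \<alpha>)"
proof -
  have "reflection \<alpha> = (\<lambda>x. x - (2 / (norm \<alpha>)\<^sup>2 * (\<alpha> \<bullet> x)) *\<^sub>R \<alpha>)"
    by (auto simp: reflection_def)
  moreover have "bounded_linear \<dots>"
    by (intro bounded_linear_sub bounded_linear_ident bounded_linear_scaleR_const
      bounded_linear_mult_const bounded_linear_const_mult bounded_linear_inner_right)
  ultimately show ?thesis by simp
qed

text \<open>The quotient behind the difference part of a Dunkl operator extends continuously over the hyperplane. For
linear functions it is a constant, and the product rule
$fg - (fg) \circ \sigma = (f - f \circ \sigma) g + (f \circ \sigma) (g - g \circ \sigma)$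
propagates it to all polynomials.\<close>

lemma reflection_divided_difference:
  assumes "real_polynomial_function p"
  shows "\<exists>r. continuous_on UNIV r \<and> (\<forall>x. p x - p (reflection \<alpha> x) = (\<alpha> \<bullet> x) * r x)"
  using assms
proof induction
  case (linear f)
  then have "f x - f (reflection \<alpha> x) = (\<alpha> \<bullet> x) * (2 / (norm \<alpha>)\<^sup>2 * f \<alpha>)" for x
    by (simp add: reflection_def linear_simps)
  then show ?case by (intro exI[of _ "\<lambda>x. 2 / (norm \<alpha>)\<^sup>2 * f \<alpha>"]) auto
next
  case (const c)
  then show ?case by (intro exI[of _ "\<lambda>x. 0"]) auto
next
  case (add f g)
  then obtain r s where rs: "continuous_on UNIV r" "continuous_on UNIV s"
    "\<And>x. f x - f (reflection \<alpha> x) = (\<alpha> \<bullet> x) * r x"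
    "\<And>x. g x - g (reflection \<alpha> x) = (\<alpha> \<bullet> x) * s x" by blast
  have "continuous_on UNIV (\<lambda>x. r x + s x)" by (intro continuous_on_add rs)
  moreover have "f x + g x - (f (reflection \<alpha> x) + g (reflection \<alpha> x)) = (\<alpha> \<bullet> x) * (r x + s x)" for x
    using rs(3)[of x] rs(4)[of x] by (simp add: algebra_simps)
  ultimately show ?case by (intro exI[of _ "\<lambda>x. r x + s x"]) blast
next
  case (mult f g)
  then obtain r s where rs: "continuous_on UNIV r" "continuous_on UNIV s"
    "\<And>x. f x - f (reflection \<alpha> x) = (\<alpha> \<bullet> x) * r x"
    "\<And>x. g x - g (reflection \<alpha> x) = (\<alpha> \<bullet> x) * s x" by blast
  have "continuous_on UNIV g" "continuous_on UNIV f"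
    using mult by (auto intro: continuous_on_real_polynomial_function)
  moreover have "continuous_on UNIV (reflection \<alpha>)"
    by (rule linear_continuous_on[OF bounded_linear_reflection])
  ultimately have "continuous_on UNIV (\<lambda>x. f (reflection \<alpha> x))" and "continuous_on UNIV g"
    using continuous_on_compose2[of UNIV f UNIV "reflection \<alpha>"] by simp_all
  then have "continuous_on UNIV (\<lambda>x. r x * g x + f (reflection \<alpha> x) * s x)"
    by (intro continuous_on_add continuous_on_mult rs)
  moreover have "f x * g x - f (reflection \<alpha> x) * g (reflection \<alpha> x) =
      (\<alpha> \<bullet> x) * (r x * g x + f (reflection \<alpha> x) * s x)" for x
  proof -
    have "f x * g x - f (reflection \<alpha> x) * g (reflection \<alpha> x) =
      (f x - f (reflection \<alpha> x)) * g x + f (reflection \<alpha> x) * (g x - g (reflection \<alpha> x))"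
      by (simp add: algebra_simps)
    then show ?thesis unfolding rs(3,4) by (simp add: algebra_simps)
  qed
  ultimately show ?case
    by (intro exI[of _ "\<lambda>x. r x * g x + f (reflection \<alpha> x) * s x"]) blast
qed

section \<open>Reflections and Lebesgue measure\<close>

lemma inner_reflection: "x \<bullet> reflection \<alpha> y = reflection \<alpha> x \<bullet> y"
  by (simp add: reflection_def inner_diff_left inner_diff_right inner_commute)

lemma reflection_involution [simp]: "reflection \<alpha> (reflection \<alpha> x) = x"
proof (cases "\<alpha> = 0")
  case False
  then have "\<alpha> \<bullet> reflection \<alpha> x = - (\<alpha> \<bullet> x)"
    by (simp add: reflection_def inner_diff_right power2_norm_eq_inner)
  then show ?thesis
    by (simp add: reflection_def[of \<alpha> "reflection \<alpha> x"]) (simp add: reflection_def)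
qed (simp add: reflection_def)

lemma norm_reflection [simp]: "norm (reflection \<alpha> x) = norm x"
  by (simp add: norm_eq_sqrt_inner inner_reflection)

lemma reflection_self: "\<alpha> \<noteq> 0 \<Longrightarrow> reflection \<alpha> \<alpha> = - \<alpha>"
  by (simp add: reflection_def power2_norm_eq_inner scaleR_2)

lemma inner_root_reflection: "\<alpha> \<noteq> 0 \<Longrightarrow> \<alpha> \<bullet> reflection \<alpha> x = - (\<alpha> \<bullet> x)"
  by (simp add: inner_reflection reflection_self)

lemma borel_measurable_reflection [measurable]: "reflection \<alpha> \<in> borel_measurable borel"
  by (intro borel_measurable_continuous_onI linear_continuous_on bounded_linear_reflection)

lemma nn_integral_lborel_translate:
  fixes f :: "'a::euclidean_space \<Rightarrow> ennreal"
  assumes [measurable]: "f \<in> borel_measurable borel"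
  shows "(\<integral>\<^sup>+x. f (c + x) \<partial>lborel) = (\<integral>\<^sup>+x. f x \<partial>lborel)"
  by (subst (2) lborel_distr_plus[of c, symmetric]) (simp add: nn_integral_distr)

text \<open>The image measure is translation invariant, so it is a multiple of Lebesgue measure, and the factor
is $1$ because the unit ball $B$ is mapped to itself.  Both facts are contained in one application of Fubini's
theorem: $\int\int 1_B(y - \sigma x)\,1_A(y)$ equals $|B|$ times the image measure of $A$ when the translation
$y \mapsto y + \sigma x$ is made first, and $|B|\,|A|$ when $x$ is integrated first.\<close>

lemma distr_lborel_reflection: "distr lborel borel (reflection \<alpha>) = (lborel :: (real^'n) measure)"
proof (rule measure_eqI)
  fix A assume "A \<in> sets (distr lborel borel (reflection \<alpha>))"
  then have [measurable]: "A \<in> sets borel" by simp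
  let ?T = "reflection \<alpha>" and ?f = "indicator A :: real^'n \<Rightarrow> ennreal"
    and ?B = "indicator (ball 0 1) :: real^'n \<Rightarrow> ennreal"
  let ?b = "emeasure lborel (ball (0::real^'n) 1)"
  have Bm [measurable]: "?B \<in> borel_measurable borel"
    by (intro borel_measurable_indicator) simp
  have lin: "?T (x + y) = ?T x + ?T y" for x y
    by (rule linear_add[OF bounded_linear.linear[OF bounded_linear_reflection]])
  have "?b * emeasure (distr lborel borel ?T) A = (\<integral>\<^sup>+y. ?B y * (\<integral>\<^sup>+x. ?f (?T x) \<partial>lborel) \<partial>lborel)"
  proof -
    have "emeasure (distr lborel borel ?T) A = (\<integral>\<^sup>+x. ?f x \<partial>distr lborel borel ?T)"
      by simp
    also have "\<dots> = (\<integral>\<^sup>+x. ?f (?T x) \<partial>lborel)"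
      by (rule nn_integral_distr) measurable
    finally have "emeasure (distr lborel borel ?T) A = (\<integral>\<^sup>+x. ?f (?T x) \<partial>lborel)" .
    moreover have "(\<integral>\<^sup>+y. ?B y * c \<partial>lborel) = ?b * c" for c
      using Bm by (subst nn_integral_multc) auto
    ultimately show ?thesis by simp
  qed
  also have "\<dots> = (\<integral>\<^sup>+y. ?B y * (\<integral>\<^sup>+x. ?f (y + ?T x) \<partial>lborel) \<partial>lborel)"
  proof (rule nn_integral_cong)
    fix y
    have "(\<integral>\<^sup>+x. ?f (?T x) \<partial>lborel) = (\<integral>\<^sup>+x. ?f (?T (?T y + x)) \<partial>lborel)"
      by (rule nn_integral_lborel_translate[symmetric]) measurable
    then show "?B y * (\<integral>\<^sup>+x. ?f (?T x) \<partial>lborel) = ?B y * (\<integral>\<^sup>+x. ?f (y + ?T x) \<partial>lborel)"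
      by (simp add: lin)
  qed
  also have "\<dots> = (\<integral>\<^sup>+y. (\<integral>\<^sup>+x. ?B y * ?f (y + ?T x) \<partial>lborel) \<partial>lborel)"
    by (subst nn_integral_cmult) simp_all
  also have "\<dots> = (\<integral>\<^sup>+x. (\<integral>\<^sup>+y. ?B y * ?f (y + ?T x) \<partial>lborel) \<partial>lborel)"
    by (rule lborel_pair.Fubini') measurable
  also have "\<dots> = (\<integral>\<^sup>+x. (\<integral>\<^sup>+y. ?B (y - ?T x) * ?f y \<partial>lborel) \<partial>lborel)"
  proof (rule nn_integral_cong)
    fix x
    have "(\<lambda>y. ?B (y - ?T x) * ?f y) \<in> borel_measurable borel"
      by measurable
    from nn_integral_lborel_translate[OF this, of "?T x"]
    show "(\<integral>\<^sup>+y. ?B y * ?f (y + ?T x) \<partial>lborel) = (\<integral>\<^sup>+y. ?B (y - ?T x) * ?f y \<partial>lborel)"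
      by (simp add: add.commute)
  qed
  also have "\<dots> = (\<integral>\<^sup>+y. (\<integral>\<^sup>+x. ?B (y - ?T x) * ?f y \<partial>lborel) \<partial>lborel)"
    by (rule lborel_pair.Fubini'[symmetric]) measurable
  also have "\<dots> = (\<integral>\<^sup>+y. (\<integral>\<^sup>+x. ?B (y - ?T x) \<partial>lborel) * ?f y \<partial>lborel)"
    by (subst nn_integral_multc) simp_all
  also have "\<dots> = (\<integral>\<^sup>+y. ?b * ?f y \<partial>lborel)"
  proof (rule nn_integral_cong)
    fix y
    have "?B (y - ?T x) = ?B (- ?T y + x)" for x
    proof -
      have "y - ?T x = ?T (?T y - x)"
        using linear_diff[OF bounded_linear.linear[OF bounded_linear_reflection], of \<alpha> "?T y" x] by simp
      then have "norm (y - ?T x) = norm (- ?T y + x)"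
        by (metis add.commute diff_conv_add_uminus norm_minus_commute norm_reflection)
      then have "y - ?T x \<in> ball 0 1 \<longleftrightarrow> - ?T y + x \<in> ball 0 1"
        unfolding mem_ball_0 by simp
      then show ?thesis unfolding indicator_def by simp
    qed
    then have "(\<integral>\<^sup>+x. ?B (y - ?T x) \<partial>lborel) = (\<integral>\<^sup>+x. ?B (- ?T y + x) \<partial>lborel)"
      by simp
    also have "\<dots> = ?b"
      by (subst nn_integral_lborel_translate) simp_all
    finally show "(\<integral>\<^sup>+x. ?B (y - ?T x) \<partial>lborel) * ?f y = ?b * ?f y" by simp
  qed
  also have "\<dots> = ?b * emeasure lborel A"
    by (simp add: nn_integral_cmult)
  finally have "?b * emeasure (distr lborel borel ?T) A = ?b * emeasure lborel A" .
  moreover have "?b \<noteq> 0" "?b \<noteq> \<infinity>"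
    by (simp_all add: emeasure_ball less_imp_neq[OF unit_ball_vol_pos, symmetric])
  ultimately show "emeasure (distr lborel borel ?T) A = emeasure lborel A"
    by (simp add: ennreal_mult_cancel_left)
qed simp

lemma integral_reflection:
  fixes f :: "real^'n \<Rightarrow> real"
  assumes [measurable]: "f \<in> borel_measurable borel"
  shows "(\<integral>x. f (reflection \<alpha> x) \<partial>lborel) = (\<integral>x. f x \<partial>lborel)"
  by (subst (2) distr_lborel_reflection[of \<alpha>, symmetric]) (simp add: integral_distr)

lemma integrable_continuous_compact_support:
  fixes f :: "'a::euclidean_space \<Rightarrow> real"
  assumes "continuous_on UNIV f" "\<And>x. norm x > r \<Longrightarrow> f x = 0"
  shows "integrable lborel f"
proof -
  have "integrable lborel (\<lambda>x. indicator (cball 0 r) x *\<^sub>R f x)"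
    by (intro borel_integrable_compact compact_cball continuous_on_subset[OF assms(1)]) auto
  also have "(\<lambda>x. indicator (cball 0 r) x *\<^sub>R f x) = f"
    using assms(2) by (auto simp: indicator_def fun_eq_iff not_le)
  finally show ?thesis .
qed

lemma integral_lborel_translate:
  fixes f :: "'a::euclidean_space \<Rightarrow> real"
  assumes [measurable]: "f \<in> borel_measurable borel"
  shows "(\<integral>x. f (x + c) \<partial>lborel) = (\<integral>x. f x \<partial>lborel)"
  by (subst (2) lborel_distr_plus[of c, symmetric]) (simp add: integral_distr add.commute)

text \<open>The integrals of $F(x + e)$ and of $F(x)$ agree, and $F(x + e) - F(x) = \int_0^1 D(x + u e)\,du$.  By Fubini the
integral of the right-hand side over $x$ is that of $D$.  Translation takes the place of the usual splitting off
of one coordinate.\<close>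

lemma integral_directional_derivative_eq_0:
  fixes F D :: "'a::euclidean_space \<Rightarrow> real"
  assumes deriv: "\<And>x. ((\<lambda>s. F (x + s *\<^sub>R e)) has_real_derivative D x) (at 0)"
    and contF: "continuous_on UNIV F" and contD: "continuous_on UNIV D"
    and F0: "\<And>x. norm x > r \<Longrightarrow> F x = 0" and D0: "\<And>x. norm x > r \<Longrightarrow> D x = 0"
  shows "(\<integral>x. D x \<partial>lborel) = 0"
proof -
  have [measurable]: "F \<in> borel_measurable borel" "D \<in> borel_measurable borel"
    using contF contD by (auto intro: borel_measurable_continuous_onI)
  have intF: "integrable lborel F"
    by (rule integrable_continuous_compact_support[OF contF F0])
  have intFe: "integrable lborel (\<lambda>x. F (x + e))"
  proof (rule integrable_continuous_compact_support)
    show "continuous_on UNIV (\<lambda>x. F (x + e))"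
      by (intro continuous_on_compose2[OF contF] continuous_intros) auto
    show "F (x + e) = 0" if "norm x > r + norm e" for x
      using norm_triangle_ineq4[of "x + e" e] that by (intro F0) auto
  qed
  have deriv_u: "((\<lambda>s. F (x + s *\<^sub>R e)) has_real_derivative D (x + u *\<^sub>R e)) (at u)" for x u
  proof -
    have "((\<lambda>s. F (x + u *\<^sub>R e + s *\<^sub>R e)) has_real_derivative D (x + u *\<^sub>R e)) (at (u - u))"
      using deriv[of "x + u *\<^sub>R e"] by simp
    then have "((\<lambda>s. F (x + u *\<^sub>R e + (s - u) *\<^sub>R e)) has_real_derivative D (x + u *\<^sub>R e) * 1) (at u)"
      by (rule DERIV_chain2) (auto intro!: derivative_eq_intros)
    then show ?thesis by (simp add: algebra_simps)
  qed
  have FTC: "(\<integral>u. indicator {0..1} u * D (x + u *\<^sub>R e) \<partial>lborel) = F (x + e) - F x" for x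
  proof -
    have "(\<integral>u. indicator {0..1} u *\<^sub>R D (x + u *\<^sub>R e) \<partial>lborel) = F (x + 1 *\<^sub>R e) - F (x + 0 *\<^sub>R e)"
    proof (rule integral_FTC_atLeastAtMost)
      show "((\<lambda>u. F (x + u *\<^sub>R e)) has_vector_derivative D (x + u *\<^sub>R e)) (at u within {0..1})" for u
        using has_field_derivative_at_within[OF deriv_u]
        by (simp add: has_real_derivative_iff_has_vector_derivative)
      show "continuous_on {0..1} (\<lambda>u. D (x + u *\<^sub>R e))"
        by (intro continuous_on_compose2[OF contD] continuous_intros) auto
    qed simp
    then show ?thesis by simp
  qed
  have int2: "integrable (lborel \<Otimes>\<^sub>M lborel) (\<lambda>(x, u). indicator {0..1::real} u * D (x + u *\<^sub>R e))"
  proof -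
    let ?S = "cball 0 (r + norm e) \<times> {0..1::real}"
    have "integrable lborel (\<lambda>z. indicator ?S z *\<^sub>R D (fst z + snd z *\<^sub>R e))"
      by (intro borel_integrable_compact compact_Times compact_cball compact_Icc
          continuous_on_compose2[OF contD] continuous_intros) auto
    also have "(\<lambda>z. indicator ?S z *\<^sub>R D (fst z + snd z *\<^sub>R e)) =
        (\<lambda>(x, u). indicator {0..1::real} u * D (x + u *\<^sub>R e))"
    proof (intro ext, clarify)
      fix x :: 'a and u :: real
      have "D (x + u *\<^sub>R e) = 0" if u: "u \<in> {0..1}" and x: "norm x > r + norm e"
      proof (rule D0)
        have "norm (u *\<^sub>R e) \<le> norm e" using u by (simp add: mult_left_le_one_le)
        then show "norm (x + u *\<^sub>R e) > r"
          using norm_triangle_ineq4[of "x + u *\<^sub>R e" "u *\<^sub>R e"] x by simp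
      qed
      then show "indicator ?S (x, u) *\<^sub>R D (fst (x, u) + snd (x, u) *\<^sub>R e) =
          indicator {0..1} u * D (x + u *\<^sub>R e)"
        by (cases "u \<in> {0..1}"; cases "norm x \<le> r + norm e") (auto simp: not_le)
    qed
    finally show ?thesis by (simp add: lborel_prod)
  qed
  have "0 = (\<integral>x. F (x + e) \<partial>lborel) - (\<integral>x. F x \<partial>lborel)"
    by (simp add: integral_lborel_translate)
  also have "\<dots> = (\<integral>x. F (x + e) - F x \<partial>lborel)"
    by (simp add: intF intFe)
  also have "\<dots> = (\<integral>x. (\<integral>u. indicator {0..1} u * D (x + u *\<^sub>R e) \<partial>lborel) \<partial>lborel)"
    by (simp add: FTC)
  also have "\<dots> = (\<integral>u. (\<integral>x. indicator {0..1::real} u * D (x + u *\<^sub>R e) \<partial>lborel) \<partial>lborel)"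
    by (rule lborel_pair.Fubini_integral[symmetric, OF int2])
  also have "\<dots> = (\<integral>u. indicator {0..1::real} u * (\<integral>x. D x \<partial>lborel) \<partial>lborel)"
    by (simp add: integral_lborel_translate)
  also have "\<dots> = (\<integral>x. D x \<partial>lborel)"
    by simp
  finally show ?thesis by simp
qed

section \<open>The Dunkl weight, its smooth approximations, and the cut-off\<close>

text \<open>The hypotheses are those on the root system and the multiplicities.  They also hold for the empty root system,
where the Dunkl operators are the partial derivatives and the weight is $1$; this instance supplies the
facts about the ordinary Laplacian and the unweighted sphere.\<close>

locale dunkl_setting =
  fixes R P :: "(real^'n) set" and \<beta> :: "real^'n" and k :: "real^'n \<Rightarrow> real"
  assumes root_system: "normalized_root_system R"
    and regular: "regular_vector R \<beta>"
    and P_def: "P = positive_roots R \<beta>"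
    and invariant: "multiplicity_invariant R k"
    and k_nonneg: "\<And>\<alpha>. \<alpha> \<in> R \<Longrightarrow> k \<alpha> \<ge> 0"
begin

lemma finite_P: "finite P" and P_subset: "P \<subseteq> R"
  and nonzero_R: "\<alpha> \<in> R \<Longrightarrow> \<alpha> \<noteq> 0"
  using root_system by (auto simp: normalized_root_system_def P_def positive_roots_def)

lemma nonzero_P: "\<alpha> \<in> P \<Longrightarrow> \<alpha> \<noteq> 0" and k_nonneg_P: "\<alpha> \<in> P \<Longrightarrow> k \<alpha> \<ge> 0"
  using P_subset nonzero_R k_nonneg by auto

lemma uminus_R: "\<alpha> \<in> R \<Longrightarrow> - \<alpha> \<in> R"
  using root_system by (auto simp: normalized_root_system_def)

lemma reflection_R: "a \<in> R \<Longrightarrow> bij_betw (reflection a) R R"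
  using root_system
  by (auto simp: normalized_root_system_def bij_betw_def intro!: inj_on_inverseI[where g = "reflection a"])

lemma k_reflection: "a \<in> R \<Longrightarrow> \<alpha> \<in> R \<Longrightarrow> k (reflection a \<alpha>) = k \<alpha>"
  using invariant reflection_group.step[OF _ reflection_group.id, of a R]
  by (auto simp: multiplicity_invariant_def)

lemma R_split: "R = P \<union> uminus ` P" and P_disjoint: "P \<inter> uminus ` P = {}"
proof -
  have "\<alpha> \<in> uminus ` P" if "\<alpha> \<in> R" "\<alpha> \<notin> P" for \<alpha>
  proof -
    have "- \<alpha> \<in> P"
      using that regular uminus_R[OF that(1)]
      by (auto simp: P_def positive_roots_def regular_vector_def not_less le_less)
    then show ?thesis by (metis image_eqI minus_minus)
  qed
  then show "R = P \<union> uminus ` P" using P_subset uminus_R by auto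
  show "P \<inter> uminus ` P = {}" by (auto simp: P_def positive_roots_def)
qed

text \<open>A reflection does not preserve the positive system, but it permutes all roots.  Since $f$ is even, the product over
all roots is the square of the product over the positive ones, and nonnegativity allows the square to be undone.\<close>

lemma prod_P_reflection:
  fixes f :: "real^'n \<Rightarrow> real \<Rightarrow> real"
  assumes even: "\<And>\<alpha> s. \<alpha> \<in> R \<Longrightarrow> f \<alpha> (- s) = f \<alpha> s"
    and inv: "\<And>a \<alpha>. a \<in> R \<Longrightarrow> \<alpha> \<in> R \<Longrightarrow> f (reflection a \<alpha>) = f \<alpha>"
    and nonneg: "\<And>\<alpha> s. f \<alpha> s \<ge> 0" and a: "a \<in> R"
  shows "(\<Prod>\<alpha>\<in>P. f \<alpha> (\<alpha> \<bullet> reflection a x)) = (\<Prod>\<alpha>\<in>P. f \<alpha> (\<alpha> \<bullet> x))"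
proof -
  have sq: "(\<Prod>\<alpha>\<in>R. f \<alpha> (\<alpha> \<bullet> y)) = (\<Prod>\<alpha>\<in>P. f \<alpha> (\<alpha> \<bullet> y))\<^sup>2" for y
  proof -
    have "(\<Prod>\<alpha>\<in>R. f \<alpha> (\<alpha> \<bullet> y)) =
        (\<Prod>\<alpha>\<in>P. f \<alpha> (\<alpha> \<bullet> y)) * (\<Prod>\<alpha>\<in>uminus ` P. f \<alpha> (\<alpha> \<bullet> y))"
      using finite_P by (subst R_split, subst prod.union_disjoint) (auto simp: P_disjoint)
    also have "(\<Prod>\<alpha>\<in>uminus ` P. f \<alpha> (\<alpha> \<bullet> y)) = (\<Prod>\<alpha>\<in>P. f (- \<alpha>) (- (\<alpha> \<bullet> y)))"
      by (subst prod.reindex) (auto simp: inj_on_def)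
    also have "\<dots> = (\<Prod>\<alpha>\<in>P. f \<alpha> (\<alpha> \<bullet> y))"
    proof (rule prod.cong[OF refl])
      fix \<alpha> assume "\<alpha> \<in> P"
      then have \<alpha>: "\<alpha> \<in> R" using P_subset by auto
      have "f (- \<alpha>) = f \<alpha>"
        using inv[OF \<alpha> \<alpha>] reflection_self[OF nonzero_R[OF \<alpha>]] by simp
      then show "f (- \<alpha>) (- (\<alpha> \<bullet> y)) = f \<alpha> (\<alpha> \<bullet> y)" using even[OF \<alpha>] by simp
    qed
    finally show ?thesis by (simp add: power2_eq_square)
  qed
  have "(\<Prod>\<alpha>\<in>P. f \<alpha> (\<alpha> \<bullet> reflection a x))\<^sup>2 = (\<Prod>\<alpha>\<in>R. f \<alpha> (\<alpha> \<bullet> reflection a x))"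
    by (simp add: sq)
  also have "\<dots> = (\<Prod>\<alpha>\<in>R. f (reflection a \<alpha>) (reflection a \<alpha> \<bullet> x))"
    using a by (intro prod.cong) (auto simp: inv inner_reflection)
  also have "\<dots> = (\<Prod>\<alpha>\<in>R. f \<alpha> (\<alpha> \<bullet> x))"
    by (rule prod.reindex_bij_betw[OF reflection_R[OF a], of "\<lambda>\<alpha>. f \<alpha> (\<alpha> \<bullet> x)"])
  also have "\<dots> = (\<Prod>\<alpha>\<in>P. f \<alpha> (\<alpha> \<bullet> x))\<^sup>2" by (simp add: sq)
  finally show ?thesis
    by (subst (asm) power2_eq_iff_nonneg) (auto intro: prod_nonneg nonneg)
qed

text \<open>This is $\prod_\alpha (\langle\alpha,x\rangle^2 + \epsilon)^{k(\alpha)}$.  The exponential form makes it visibly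
positive and turns its logarithmic derivative into a plain sum.\<close>

definition smooth_weight :: "real \<Rightarrow> real^'n \<Rightarrow> real" where
  "smooth_weight \<epsilon> x = exp (\<Sum>\<alpha>\<in>P. k \<alpha> * ln ((\<alpha> \<bullet> x)\<^sup>2 + \<epsilon>))"

lemma smooth_weight_pos: "smooth_weight \<epsilon> x > 0" by (simp add: smooth_weight_def)

lemma smooth_weight_reflection:
  assumes "a \<in> R"
  shows "smooth_weight \<epsilon> (reflection a x) = smooth_weight \<epsilon> x"
  using prod_P_reflection[of "\<lambda>\<alpha> s. exp (k \<alpha> * ln (s\<^sup>2 + \<epsilon>))" a x] assms finite_P
  by (simp add: smooth_weight_def exp_sum k_reflection)

lemma dunkl_weight_reflection:
  assumes "a \<in> R"
  shows "dunkl_weight P k (reflection a x) = dunkl_weight P k x"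
  using prod_P_reflection[of "\<lambda>\<alpha> s. \<bar>s\<bar> powr (2 * k \<alpha>)" a x] assms
  by (simp add: dunkl_weight_def k_reflection)

lemma continuous_smooth_weight: "\<epsilon> > 0 \<Longrightarrow> continuous_on UNIV (smooth_weight \<epsilon>)"
  unfolding smooth_weight_def[abs_def]
  by (intro continuous_on_exp continuous_on_sum continuous_on_mult continuous_on_const
      continuous_on_ln continuous_on_add continuous_on_power continuous_on_inner continuous_on_id)
    (auto simp: add_nonneg_eq_0_iff)

lemma smooth_weight_mono:
  assumes "0 < \<epsilon>" "\<epsilon> \<le> \<delta>"
  shows "smooth_weight \<epsilon> x \<le> smooth_weight \<delta> x"
proof -
  have "k \<alpha> * ln ((\<alpha> \<bullet> x)\<^sup>2 + \<epsilon>) \<le> k \<alpha> * ln ((\<alpha> \<bullet> x)\<^sup>2 + \<delta>)" if "\<alpha> \<in> P" for \<alpha>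
    using assms k_nonneg_P[OF that] zero_le_power2[of "\<alpha> \<bullet> x"]
    by (intro mult_left_mono) (auto simp: add_nonneg_pos)
  then show ?thesis by (auto simp: smooth_weight_def intro: sum_mono)
qed

lemma dunkl_weight_nonneg: "dunkl_weight P k x \<ge> 0"
  by (simp add: dunkl_weight_def prod_nonneg)

text \<open>This bound makes the weight locally bounded, hence products with compactly supported continuous functions
integrable.\<close>

lemma dunkl_weight_le: "dunkl_weight P k x \<le> smooth_weight 1 x"
proof -
  have "\<bar>\<alpha> \<bullet> x\<bar> powr (2 * k \<alpha>) \<le> exp (k \<alpha> * ln ((\<alpha> \<bullet> x)\<^sup>2 + 1))" if "\<alpha> \<in> P" for \<alpha>
  proof (cases "\<alpha> \<bullet> x = 0")
    case False
    have "2 * ln \<bar>\<alpha> \<bullet> x\<bar> = ln ((\<alpha> \<bullet> x)\<^sup>2)" 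
      using ln_realpow[of "\<bar>\<alpha> \<bullet> x\<bar>" 2] False by simp
    also have "\<dots> \<le> ln ((\<alpha> \<bullet> x)\<^sup>2 + 1)" using False by (simp add: add_pos_pos)
    finally have "k \<alpha> * (2 * ln \<bar>\<alpha> \<bullet> x\<bar>) \<le> k \<alpha> * ln ((\<alpha> \<bullet> x)\<^sup>2 + 1)"
      by (rule mult_left_mono) (rule k_nonneg_P[OF that])
    then show ?thesis using False by (simp add: powr_def mult_ac)
  qed simp
  then show ?thesis
    unfolding dunkl_weight_def smooth_weight_def exp_sum[OF finite_P]
    by (intro prod_mono) auto
qed

lemma measurable_dunkl_weight [measurable]: "dunkl_weight P k \<in> borel_measurable borel"
  unfolding dunkl_weight_def[abs_def] by measurable

lemma AE_off_hyperplanes: "AE x in lborel. \<forall>\<alpha>\<in>P. \<alpha> \<bullet> x \<noteq> 0"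
proof -
  have "AE x in lborel. \<alpha> \<bullet> x \<noteq> 0" if "\<alpha> \<in> P" for \<alpha>
  proof -
    have "negligible {x. \<alpha> \<bullet> x = 0}" using nonzero_P[OF that] by (intro negligible_hyperplane) auto
    then have "{x. \<alpha> \<bullet> x = 0} \<in> null_sets (completion lborel)" by (simp add: negligible_iff_null_sets)
    then have "{x. \<alpha> \<bullet> x = 0} \<in> null_sets lborel"
      by (subst (asm) null_sets_completion_iff) (auto intro: closed_hyperplane borel_closed)
    then show ?thesis by (auto dest: AE_not_in)
  qed
  with finite_P show ?thesis by (subst AE_ball_countable) (auto intro: countable_finite)
qed

lemma integrable_times_dunkl_weight:
  assumes "continuous_on UNIV f" "\<And>x. norm x > r \<Longrightarrow> f x = 0"
  shows "integrable lborel (\<lambda>x. f x * dunkl_weight P k x)"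
proof (rule Bochner_Integration.integrable_bound)
  show "integrable lborel (\<lambda>x. \<bar>f x\<bar> * smooth_weight 1 x)"
    using assms(2)
    by (intro integrable_continuous_compact_support[of _ r] continuous_on_mult continuous_on_rabs
        assms(1) continuous_smooth_weight) auto
  have [measurable]: "f \<in> borel_measurable borel"
    using assms by (intro borel_measurable_continuous_onI)
  show "(\<lambda>x. f x * dunkl_weight P k x) \<in> borel_measurable lborel" by measurable
  show "AE x in lborel. norm (f x * dunkl_weight P k x) \<le> norm (\<bar>f x\<bar> * smooth_weight 1 x)"
    using dunkl_weight_le dunkl_weight_nonneg smooth_weight_pos[THEN less_imp_le]
    by (auto simp: abs_mult intro!: mult_left_mono)
qed

end

text \<open>The cut-off for the integrations by parts is the square of this function: it is $C^1$ with compact support,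
invariant under reflections, and its integrals against homogeneous functions are beta function values.\<close>

definition bump :: "'a::real_normed_vector \<Rightarrow> real" where
  "bump x = max 0 (1 - (norm x)\<^sup>2)"

lemma bump_eq_0: "norm x > 1 \<Longrightarrow> bump x = 0"
  using one_less_power[of "norm x" 2] by (auto simp: bump_def)

lemma continuous_bump: "continuous_on S bump"
  unfolding bump_def[abs_def] by (intro continuous_intros)

lemma bump_reflection [simp]: "bump (reflection \<alpha> x) = bump x"
  by (simp add: bump_def)

lemma DERIV_max_0_square: "((\<lambda>u::real. (max 0 u)\<^sup>2) has_real_derivative 2 * max 0 u) (at u)"
proof (cases u "0::real" rule: linorder_cases)
  case less
  have "((\<lambda>u::real. 0) has_real_derivative 2 * max 0 u) (at u)" using less by simp
  then show ?thesis
    by (rule has_field_derivative_transform_within_open[where S = "{..<0}"]) (use less in auto)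
next
  case equal
  have "\<exists>g. (\<forall>z. (max 0 z)\<^sup>2 - (max 0 u)\<^sup>2 = g z * (z - u)) \<and> isCont g u \<and> g u = 2 * max 0 u"
  proof (intro exI[of _ "\<lambda>z. max 0 z"] conjI allI)
    show "isCont (\<lambda>z. max 0 z) u" by (intro continuous_intros)
  qed (auto simp: equal power2_eq_square max_def)
  then show ?thesis by (simp add: CARAT_DERIV)
next
  case greater
  have "((\<lambda>u::real. u\<^sup>2) has_real_derivative 2 * max 0 u) (at u)"
    using greater by (auto intro!: derivative_eq_intros)
  then show ?thesis
    by (rule has_field_derivative_transform_within_open[where S = "{0<..}"]) (use greater in auto)
qed

lemma DERIV_bump_square:
  "((\<lambda>s. (bump (x + s *\<^sub>R e))\<^sup>2) has_real_derivative - 4 * (x \<bullet> e) * bump x) (at 0)"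
proof -
  have "((\<lambda>s. 1 - ((x \<bullet> x) + s * (2 * (x \<bullet> e)) + s\<^sup>2 * (e \<bullet> e))) has_real_derivative - (2 * (x \<bullet> e))) (at 0)"
    by (auto intro!: derivative_eq_intros)
  also have "(\<lambda>s. 1 - ((x \<bullet> x) + s * (2 * (x \<bullet> e)) + s\<^sup>2 * (e \<bullet> e))) = (\<lambda>s. 1 - (norm (x + s *\<^sub>R e))\<^sup>2)"
    unfolding power2_norm_eq_inner
    by (auto simp: inner_add_left inner_add_right inner_commute power2_eq_square algebra_simps)
  finally have "((\<lambda>s. (max 0 (1 - (norm (x + s *\<^sub>R e))\<^sup>2))\<^sup>2) has_real_derivative
      2 * max 0 (1 - (norm (x + 0 *\<^sub>R e))\<^sup>2) * - (2 * (x \<bullet> e))) (at 0)"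
    by (rule DERIV_chain2[OF DERIV_max_0_square])
  then show ?thesis by (simp add: bump_def mult_ac)
qed

section \<open>Integration by parts for Dunkl operators\<close>

context dunkl_setting
begin

lemma DERIV_smooth_weight:
  assumes "\<epsilon> > 0"
  shows "((\<lambda>s. smooth_weight \<epsilon> (x + s *\<^sub>R axis j 1)) has_real_derivative
    smooth_weight \<epsilon> x * (\<Sum>\<alpha>\<in>P. 2 * k \<alpha> * \<alpha> $ j * ((\<alpha> \<bullet> x) / ((\<alpha> \<bullet> x)\<^sup>2 + \<epsilon>)))) (at 0)"
proof -
  have "((\<lambda>s. k \<alpha> * ln ((\<alpha> \<bullet> (x + s *\<^sub>R axis j 1))\<^sup>2 + \<epsilon>)) has_real_derivative
      2 * k \<alpha> * \<alpha> $ j * ((\<alpha> \<bullet> x) / ((\<alpha> \<bullet> x)\<^sup>2 + \<epsilon>))) (at 0)" for \<alpha>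
  proof -
    have pos: "(\<alpha> \<bullet> x)\<^sup>2 + \<epsilon> > 0" using assms by (simp add: add_nonneg_pos)
    have "((\<lambda>s. k \<alpha> * ln ((\<alpha> \<bullet> x + s * \<alpha> $ j)\<^sup>2 + \<epsilon>)) has_real_derivative
      2 * k \<alpha> * \<alpha> $ j * ((\<alpha> \<bullet> x) / ((\<alpha> \<bullet> x)\<^sup>2 + \<epsilon>))) (at 0)"
      using pos by (auto intro!: derivative_eq_intros)
    then show ?thesis by (simp add: inner_add_right inner_axis)
  qed
  then have "((\<lambda>s. \<Sum>\<alpha>\<in>P. k \<alpha> * ln ((\<alpha> \<bullet> (x + s *\<^sub>R axis j 1))\<^sup>2 + \<epsilon>)) has_real_derivative
      (\<Sum>\<alpha>\<in>P. 2 * k \<alpha> * \<alpha> $ j * ((\<alpha> \<bullet> x) / ((\<alpha> \<bullet> x)\<^sup>2 + \<epsilon>)))) (at 0)"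
    by (rule DERIV_sum)
  from DERIV_fun_exp[OF this] show ?thesis by (simp add: smooth_weight_def)
qed

text \<open>The integral of the $j$-th partial derivative of $q\,b^2$ times the smooth weight vanishes.  The term from the
derivative of the weight at a root $\alpha$ is $q$ times a function \<open>h \<alpha>\<close> that is odd under
$\sigma_\alpha$, so its integral is half of that of $(q - q \circ \sigma_\alpha)$ times \<open>h \<alpha>\<close>.
The denominator $\langle\alpha,x\rangle^2 + \epsilon$ is then compensated by a factor
$\langle\alpha,x\rangle^2$, which keeps the integrand bounded uniformly in $\epsilon$.\<close>

lemma smooth_integration_by_parts:
  assumes eps: "\<epsilon> > 0" and q: "real_polynomial_function q"
    and contr: "\<And>\<alpha>. continuous_on UNIV (r \<alpha>)"
    and r: "\<And>\<alpha> x. q x - q (reflection \<alpha> x) = (\<alpha> \<bullet> x) * r \<alpha> x"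
  shows "(\<integral>x. ((partial_deriv j q x * (bump x)\<^sup>2 - 4 * (x $ j * q x) * bump x) +
      (\<Sum>\<alpha>\<in>P. k \<alpha> * \<alpha> $ j * r \<alpha> x * ((\<alpha> \<bullet> x)\<^sup>2 / ((\<alpha> \<bullet> x)\<^sup>2 + \<epsilon>))) * (bump x)\<^sup>2) *
      smooth_weight \<epsilon> x \<partial>lborel) = 0"
proof -
  define h where "h \<alpha> x = (bump x)\<^sup>2 * smooth_weight \<epsilon> x * ((\<alpha> \<bullet> x) / ((\<alpha> \<bullet> x)\<^sup>2 + \<epsilon>))" for \<alpha> x :: "real^'n"
  define A where "A x = (partial_deriv j q x * (bump x)\<^sup>2 - 4 * (x $ j * q x) * bump x) * smooth_weight \<epsilon> x" for x
  have den: "(\<alpha> \<bullet> x)\<^sup>2 + \<epsilon> \<noteq> 0" for \<alpha> x :: "real^'n"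
    using eps zero_le_power2[of "\<alpha> \<bullet> x"] by linarith
  have conth: "continuous_on UNIV (h \<alpha>)" for \<alpha>
    unfolding h_def[abs_def]
    by (intro continuous_on_mult continuous_on_divide continuous_on_power continuous_bump
        continuous_smooth_weight eps continuous_on_inner continuous_on_const continuous_on_id continuous_on_add)
       (use den in auto)
  have contq: "continuous_on UNIV q" "continuous_on UNIV (partial_deriv j q)"
    using q by (auto intro: continuous_on_real_polynomial_function real_polynomial_function_partial_deriv)
  have contA: "continuous_on UNIV A"
    unfolding A_def[abs_def]
    by (intro continuous_on_mult continuous_on_diff continuous_on_power continuous_bump
        continuous_smooth_weight eps continuous_on_const contq continuous_on_component continuous_on_id)
  have h0: "h \<alpha> x = 0" "A x = 0" if "norm x > 1" for \<alpha> x
    using bump_eq_0[OF that] by (simp_all add: h_def A_def)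
  have intA: "integrable lborel A"
    by (rule integrable_continuous_compact_support[OF contA h0(2)])
  have intqh: "integrable lborel (\<lambda>x. q x * h \<alpha> x)" for \<alpha>
    by (rule integrable_continuous_compact_support[of _ 1]) (auto intro: continuous_on_mult contq conth simp: h0)
  have contqr: "continuous_on UNIV (\<lambda>x. q (reflection \<alpha> x))" for \<alpha>
    by (intro continuous_on_compose2[OF contq(1) linear_continuous_on[OF bounded_linear_reflection]]) auto
  have intqrh: "integrable lborel (\<lambda>x. q (reflection \<alpha> x) * h \<alpha> x)" for \<alpha>
    by (rule integrable_continuous_compact_support[of _ 1]) (auto intro: continuous_on_mult contqr conth simp: h0)
  have "(\<integral>x. A x + q x * (\<Sum>\<alpha>\<in>P. 2 * k \<alpha> * \<alpha> $ j * h \<alpha> x) \<partial>lborel) = 0"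
  proof (rule integral_directional_derivative_eq_0[where r = 1 and e = "axis j 1" and F = "\<lambda>x. q x * (bump x)\<^sup>2 * smooth_weight \<epsilon> x"])
    fix x
    have "((\<lambda>s. q (x + s *\<^sub>R axis j 1) * (bump (x + s *\<^sub>R axis j 1))\<^sup>2 * smooth_weight \<epsilon> (x + s *\<^sub>R axis j 1))
      has_real_derivative
      (partial_deriv j q x * (bump (x + 0 *\<^sub>R axis j 1))\<^sup>2 + (- 4 * (x \<bullet> axis j 1) * bump x) * q (x + 0 *\<^sub>R axis j 1)) * smooth_weight \<epsilon> (x + 0 *\<^sub>R axis j 1)
       + (smooth_weight \<epsilon> x * (\<Sum>\<alpha>\<in>P. 2 * k \<alpha> * \<alpha> $ j * ((\<alpha> \<bullet> x) / ((\<alpha> \<bullet> x)\<^sup>2 + \<epsilon>)))) * (q (x + 0 *\<^sub>R axis j 1) * (bump (x + 0 *\<^sub>R axis j 1))\<^sup>2)) (at 0)"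
      by (intro DERIV_mult partial_deriv_polynomial_at_0 q DERIV_bump_square DERIV_smooth_weight eps)
    then show "((\<lambda>s. q (x + s *\<^sub>R axis j 1) * (bump (x + s *\<^sub>R axis j 1))\<^sup>2 * smooth_weight \<epsilon> (x + s *\<^sub>R axis j 1))
      has_real_derivative A x + q x * (\<Sum>\<alpha>\<in>P. 2 * k \<alpha> * \<alpha> $ j * h \<alpha> x)) (at 0)"
      by (rule DERIV_cong) (simp add: A_def h_def inner_axis sum_distrib_left sum_distrib_right algebra_simps)
  next
    show "continuous_on UNIV (\<lambda>x. q x * (bump x)\<^sup>2 * smooth_weight \<epsilon> x)"
      by (intro continuous_on_mult continuous_on_power continuous_bump continuous_smooth_weight eps contq)
    show "continuous_on UNIV (\<lambda>x. A x + q x * (\<Sum>\<alpha>\<in>P. 2 * k \<alpha> * \<alpha> $ j * h \<alpha> x))"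
      by (intro continuous_on_add continuous_on_mult continuous_on_sum continuous_on_const contA contq conth)
  qed (auto simp: bump_eq_0 h0)
  moreover have "(\<integral>x. A x + q x * (\<Sum>\<alpha>\<in>P. 2 * k \<alpha> * \<alpha> $ j * h \<alpha> x) \<partial>lborel) =
      (\<integral>x. A x \<partial>lborel) + (\<Sum>\<alpha>\<in>P. k \<alpha> * \<alpha> $ j * (2 * (\<integral>x. q x * h \<alpha> x \<partial>lborel)))"
  proof -
    have eq: "(\<lambda>x. A x + q x * (\<Sum>\<alpha>\<in>P. 2 * k \<alpha> * \<alpha> $ j * h \<alpha> x)) =
        (\<lambda>x. A x + (\<Sum>\<alpha>\<in>P. (2 * k \<alpha> * \<alpha> $ j) * (q x * h \<alpha> x)))"
      by (simp add: sum_distrib_left mult_ac)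
    have "(\<integral>x. A x + q x * (\<Sum>\<alpha>\<in>P. 2 * k \<alpha> * \<alpha> $ j * h \<alpha> x) \<partial>lborel) =
        (\<integral>x. A x \<partial>lborel) + (\<Sum>\<alpha>\<in>P. (2 * k \<alpha> * \<alpha> $ j) * (\<integral>x. q x * h \<alpha> x \<partial>lborel))"
      unfolding eq by (subst Bochner_Integration.integral_add) (auto simp: intA intqh)
    then show ?thesis by (simp add: mult_ac)
  qed
  moreover have "2 * (\<integral>x. q x * h \<alpha> x \<partial>lborel) = (\<integral>x. (\<alpha> \<bullet> x) * r \<alpha> x * h \<alpha> x \<partial>lborel)"
    if "\<alpha> \<in> P" for \<alpha>
  proof -
    have \<alpha>: "\<alpha> \<in> R" using that P_subset by auto
    have "h \<alpha> (reflection \<alpha> x) = - h \<alpha> x" for x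
      using smooth_weight_reflection[OF \<alpha>] inner_root_reflection[OF nonzero_R[OF \<alpha>]]
      by (simp add: h_def)
    moreover have "(\<lambda>x. q x * h \<alpha> x) \<in> borel_measurable borel"
      by (intro borel_measurable_continuous_onI continuous_on_mult contq conth)
    ultimately have "(\<integral>x. q (reflection \<alpha> x) * h \<alpha> x \<partial>lborel) = - (\<integral>x. q x * h \<alpha> x \<partial>lborel)"
      using integral_reflection[of "\<lambda>x. q x * h \<alpha> x" \<alpha>] by simp
    then have "2 * (\<integral>x. q x * h \<alpha> x \<partial>lborel) =
        (\<integral>x. q x * h \<alpha> x \<partial>lborel) - (\<integral>x. q (reflection \<alpha> x) * h \<alpha> x \<partial>lborel)"
      by simp
    also have "\<dots> = (\<integral>x. (q x - q (reflection \<alpha> x)) * h \<alpha> x \<partial>lborel)"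
      using intqh intqrh by (simp add: left_diff_distrib)
    finally show ?thesis by (simp add: r)
  qed
  ultimately have "0 = (\<integral>x. A x \<partial>lborel) +
      (\<Sum>\<alpha>\<in>P. k \<alpha> * \<alpha> $ j * (\<integral>x. (\<alpha> \<bullet> x) * r \<alpha> x * h \<alpha> x \<partial>lborel))"
    by simp
  also have "\<dots> = (\<integral>x. A x + (\<Sum>\<alpha>\<in>P. k \<alpha> * \<alpha> $ j * ((\<alpha> \<bullet> x) * r \<alpha> x * h \<alpha> x)) \<partial>lborel)"
  proof -
    have "integrable lborel (\<lambda>x. (\<alpha> \<bullet> x) * r \<alpha> x * h \<alpha> x)" for \<alpha>
      by (rule integrable_continuous_compact_support[of _ 1])
         (auto intro!: continuous_on_mult contr conth continuous_on_inner continuous_on_const continuous_on_id simp: h0)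
    then show ?thesis
      by (subst Bochner_Integration.integral_add) (auto simp: intA)
  qed
  also have "(\<lambda>x. A x + (\<Sum>\<alpha>\<in>P. k \<alpha> * \<alpha> $ j * ((\<alpha> \<bullet> x) * r \<alpha> x * h \<alpha> x))) =
    (\<lambda>x. ((partial_deriv j q x * (bump x)\<^sup>2 - 4 * (x $ j * q x) * bump x) +
      (\<Sum>\<alpha>\<in>P. k \<alpha> * \<alpha> $ j * r \<alpha> x * ((\<alpha> \<bullet> x)\<^sup>2 / ((\<alpha> \<bullet> x)\<^sup>2 + \<epsilon>))) * (bump x)\<^sup>2) *
      smooth_weight \<epsilon> x)"
  proof
    fix x
    have "(\<Sum>\<alpha>\<in>P. k \<alpha> * \<alpha> $ j * ((\<alpha> \<bullet> x) * r \<alpha> x * h \<alpha> x)) =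
      (\<Sum>\<alpha>\<in>P. k \<alpha> * \<alpha> $ j * r \<alpha> x * ((\<alpha> \<bullet> x)\<^sup>2 / ((\<alpha> \<bullet> x)\<^sup>2 + \<epsilon>)) * ((bump x)\<^sup>2 * smooth_weight \<epsilon> x))"
      by (intro sum.cong) (auto simp: h_def power2_eq_square)
    also have "\<dots> = (\<Sum>\<alpha>\<in>P. k \<alpha> * \<alpha> $ j * r \<alpha> x * ((\<alpha> \<bullet> x)\<^sup>2 / ((\<alpha> \<bullet> x)\<^sup>2 + \<epsilon>))) * ((bump x)\<^sup>2 * smooth_weight \<epsilon> x)"
      by (simp only: sum_distrib_right)
    finally show "A x + (\<Sum>\<alpha>\<in>P. k \<alpha> * \<alpha> $ j * ((\<alpha> \<bullet> x) * r \<alpha> x * h \<alpha> x)) =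
     ((partial_deriv j q x * (bump x)\<^sup>2 - 4 * (x $ j * q x) * bump x) +
      (\<Sum>\<alpha>\<in>P. k \<alpha> * \<alpha> $ j * r \<alpha> x * ((\<alpha> \<bullet> x)\<^sup>2 / ((\<alpha> \<bullet> x)\<^sup>2 + \<epsilon>))) * (bump x)\<^sup>2) *
      smooth_weight \<epsilon> x"
      by (simp only: A_def distrib_right mult.assoc)
  qed
  finally show ?thesis by simp
qed

lemma smooth_weight_tendsto:
  assumes "\<forall>\<alpha>\<in>P. \<alpha> \<bullet> x \<noteq> 0"
  shows "(\<lambda>m. smooth_weight (1 / real (Suc m)) x) \<longlonglongrightarrow> dunkl_weight P k x"
proof -
  have "(\<lambda>m. exp (k \<alpha> * ln ((\<alpha> \<bullet> x)\<^sup>2 + 1 / real (Suc m)))) \<longlonglongrightarrow> \<bar>\<alpha> \<bullet> x\<bar> powr (2 * k \<alpha>)" if "\<alpha> \<in> P" for \<alpha>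
  proof -
    have nz: "\<alpha> \<bullet> x \<noteq> 0" using assms that by auto
    have "(\<lambda>m. 1 / real (Suc m)) \<longlonglongrightarrow> 0"
      using LIMSEQ_Suc[OF lim_1_over_n] by simp
    then have "(\<lambda>m. (\<alpha> \<bullet> x)\<^sup>2 + 1 / real (Suc m)) \<longlonglongrightarrow> (\<alpha> \<bullet> x)\<^sup>2 + 0"
      by (intro tendsto_add tendsto_const)
    then have "(\<lambda>m. exp (k \<alpha> * ln ((\<alpha> \<bullet> x)\<^sup>2 + 1 / real (Suc m)))) \<longlonglongrightarrow> exp (k \<alpha> * ln ((\<alpha> \<bullet> x)\<^sup>2))"
      using nz by (intro tendsto_exp tendsto_mult tendsto_const tendsto_ln) auto
    moreover have "ln ((\<alpha> \<bullet> x)\<^sup>2) = 2 * ln \<bar>\<alpha> \<bullet> x\<bar>"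
      using ln_realpow[of "\<bar>\<alpha> \<bullet> x\<bar>" 2] nz by simp
    ultimately show ?thesis using nz by (simp add: powr_def mult_ac)
  qed
  then show ?thesis
    unfolding smooth_weight_def dunkl_weight_def exp_sum[OF finite_P] by (rule tendsto_prod)
qed

text \<open>The limit $\epsilon \to 0$ of the preceding identity.  The smooth weights with $\epsilon \le 1$ are dominated by
the one with $\epsilon = 1$.\<close>

lemma integration_by_parts:
  assumes q: "real_polynomial_function q"
    and contr: "\<And>\<alpha>. continuous_on UNIV (r \<alpha>)"
    and r: "\<And>\<alpha> x. q x - q (reflection \<alpha> x) = (\<alpha> \<bullet> x) * r \<alpha> x"
  shows "(\<integral>x. ((partial_deriv j q x * (bump x)\<^sup>2 - 4 * (x $ j * q x) * bump x) +
      (\<Sum>\<alpha>\<in>P. k \<alpha> * \<alpha> $ j * r \<alpha> x) * (bump x)\<^sup>2) * dunkl_weight P k x \<partial>lborel) = 0"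
proof -
  define B where "B x = partial_deriv j q x * (bump x)\<^sup>2 - 4 * (x $ j * q x) * bump x" for x
  \<comment> \<open>the factors \<open>c m \<alpha> x\<close> lie in the unit interval and tend to 1 off the hyperplanes\<close>
  define \<epsilon> where "\<epsilon> m = 1 / real (Suc m)" for m
  have \<epsilon>: "\<epsilon> m > 0" "\<epsilon> m \<le> 1" for m by (auto simp: \<epsilon>_def)
  define c where "c m \<alpha> x = (\<alpha> \<bullet> x)\<^sup>2 / ((\<alpha> \<bullet> x)\<^sup>2 + \<epsilon> m)" for m and \<alpha> x :: "real^'n"
  have c: "0 \<le> c m \<alpha> x" "c m \<alpha> x \<le> 1" for m \<alpha> x
  proof -
    have "(\<alpha> \<bullet> x)\<^sup>2 + \<epsilon> m > 0" using \<epsilon>(1)[of m] by (simp add: add_nonneg_pos)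
    then show "0 \<le> c m \<alpha> x" "c m \<alpha> x \<le> 1" using \<epsilon>(1)[of m] by (auto simp: c_def divide_le_eq)
  qed
  have contq: "continuous_on UNIV q" "continuous_on UNIV (partial_deriv j q)"
    using q by (auto intro: continuous_on_real_polynomial_function real_polynomial_function_partial_deriv)
  have contB: "continuous_on UNIV B"
    unfolding B_def[abs_def]
    by (intro continuous_on_mult continuous_on_diff continuous_on_power continuous_bump
        continuous_on_const contq continuous_on_component continuous_on_id)
  have B0: "B x = 0" if "norm x > 1" for x
    using bump_eq_0[OF that] by (simp add: B_def)
  have [measurable]: "B \<in> borel_measurable borel" "\<And>\<alpha>. r \<alpha> \<in> borel_measurable borel"
    "bump \<in> borel_measurable borel" "\<And>m. smooth_weight (\<epsilon> m) \<in> borel_measurable borel"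
    by (intro borel_measurable_continuous_onI contB contr continuous_bump continuous_smooth_weight \<epsilon>)+
  let ?s = "\<lambda>m x. (B x + (\<Sum>\<alpha>\<in>P. k \<alpha> * \<alpha> $ j * r \<alpha> x * c m \<alpha> x) * (bump x)\<^sup>2) * smooth_weight (\<epsilon> m) x"
  let ?f = "\<lambda>x. (B x + (\<Sum>\<alpha>\<in>P. k \<alpha> * \<alpha> $ j * r \<alpha> x) * (bump x)\<^sup>2) * dunkl_weight P k x"
  let ?w = "\<lambda>x. (\<bar>B x\<bar> + (\<Sum>\<alpha>\<in>P. \<bar>k \<alpha> * \<alpha> $ j * r \<alpha> x\<bar>) * (bump x)\<^sup>2) * smooth_weight 1 x"
  have "(\<lambda>m. integral\<^sup>L lborel (?s m)) \<longlonglongrightarrow> integral\<^sup>L lborel ?f"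
  proof (rule integral_dominated_convergence[where w = ?w])
    show "?f \<in> borel_measurable lborel" by measurable
    show "?s m \<in> borel_measurable lborel" for m unfolding c_def by measurable
    show "integrable lborel ?w"
      by (rule integrable_continuous_compact_support[of _ 1])
         (auto intro!: continuous_on_mult continuous_on_add continuous_on_sum continuous_on_power
          continuous_on_rabs continuous_bump continuous_on_const contB contr continuous_smooth_weight
          simp: bump_eq_0 B0)
    show "AE x in lborel. (\<lambda>m. ?s m x) \<longlonglongrightarrow> ?f x"
      using AE_off_hyperplanes
    proof eventually_elim
      case (elim x)
      have "(\<lambda>m. c m \<alpha> x) \<longlonglongrightarrow> 1" if "\<alpha> \<in> P" for \<alpha>
      proof -
        have "\<epsilon> \<longlonglongrightarrow> 0" using LIMSEQ_Suc[OF lim_1_over_n] by (simp add: \<epsilon>_def[abs_def])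
        then have "(\<lambda>m. c m \<alpha> x) \<longlonglongrightarrow> (\<alpha> \<bullet> x)\<^sup>2 / ((\<alpha> \<bullet> x)\<^sup>2 + 0)"
          using elim that unfolding c_def by (intro tendsto_divide tendsto_add tendsto_const) auto
        then show ?thesis using elim that by simp
      qed
      then have "(\<lambda>m. \<Sum>\<alpha>\<in>P. k \<alpha> * \<alpha> $ j * r \<alpha> x * c m \<alpha> x) \<longlonglongrightarrow> (\<Sum>\<alpha>\<in>P. k \<alpha> * \<alpha> $ j * r \<alpha> x * 1)"
        by (intro tendsto_sum tendsto_mult tendsto_const)
      then have "(\<lambda>m. \<Sum>\<alpha>\<in>P. k \<alpha> * \<alpha> $ j * r \<alpha> x * c m \<alpha> x) \<longlonglongrightarrow> (\<Sum>\<alpha>\<in>P. k \<alpha> * \<alpha> $ j * r \<alpha> x)"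
        by simp
      then show ?case
        using smooth_weight_tendsto[OF elim] unfolding \<epsilon>_def
        by (intro tendsto_mult tendsto_add tendsto_const)
    qed
    show "AE x in lborel. norm (?s m x) \<le> ?w x" for m
    proof (rule AE_I2)
      fix x
      have "\<bar>\<Sum>\<alpha>\<in>P. k \<alpha> * \<alpha> $ j * r \<alpha> x * c m \<alpha> x\<bar> \<le> (\<Sum>\<alpha>\<in>P. \<bar>k \<alpha> * \<alpha> $ j * r \<alpha> x\<bar>)"
      proof (rule order_trans[OF sum_abs], rule sum_mono)
        fix \<alpha>
        show "\<bar>k \<alpha> * \<alpha> $ j * r \<alpha> x * c m \<alpha> x\<bar> \<le> \<bar>k \<alpha> * \<alpha> $ j * r \<alpha> x\<bar>"
          using c[of m \<alpha> x] mult_left_le[of "c m \<alpha> x" "\<bar>k \<alpha> * \<alpha> $ j * r \<alpha> x\<bar>"]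
          by (simp add: abs_mult)
      qed
      then have "\<bar>(\<Sum>\<alpha>\<in>P. k \<alpha> * \<alpha> $ j * r \<alpha> x * c m \<alpha> x) * (bump x)\<^sup>2\<bar> \<le>
          (\<Sum>\<alpha>\<in>P. \<bar>k \<alpha> * \<alpha> $ j * r \<alpha> x\<bar>) * (bump x)\<^sup>2"
        by (simp add: abs_mult mult_right_mono)
      then have "\<bar>B x + (\<Sum>\<alpha>\<in>P. k \<alpha> * \<alpha> $ j * r \<alpha> x * c m \<alpha> x) * (bump x)\<^sup>2\<bar> \<le>
          \<bar>B x\<bar> + (\<Sum>\<alpha>\<in>P. \<bar>k \<alpha> * \<alpha> $ j * r \<alpha> x\<bar>) * (bump x)\<^sup>2"
        by (rule order_trans[OF abs_triangle_ineq add_left_mono])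
      then have "\<bar>B x + (\<Sum>\<alpha>\<in>P. k \<alpha> * \<alpha> $ j * r \<alpha> x * c m \<alpha> x) * (bump x)\<^sup>2\<bar> * smooth_weight (\<epsilon> m) x \<le> ?w x"
        using smooth_weight_mono[OF \<epsilon>(1) \<epsilon>(2)] smooth_weight_pos[THEN less_imp_le]
        by (intro mult_mono) (auto simp: sum_nonneg)
      then show "norm (?s m x) \<le> ?w x"
        using smooth_weight_pos[of "\<epsilon> m" x] by (simp add: abs_mult)
    qed
  qed
  moreover have "integral\<^sup>L lborel (?s m) = 0" for m
    unfolding B_def c_def by (rule smooth_integration_by_parts[OF \<epsilon>(1) q contr r])
  ultimately have "integral\<^sup>L lborel ?f = 0"
    by (simp add: LIMSEQ_const_iff)
  then show ?thesis by (simp add: B_def)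
qed

lemma dunkl_operator_off_hyperplanes:
  assumes "\<forall>\<alpha>\<in>P. \<alpha> \<bullet> x \<noteq> 0"
    and "\<And>\<alpha> x. q x - q (reflection \<alpha> x) = (\<alpha> \<bullet> x) * r \<alpha> x"
  shows "dunkl_operator P k j q x = partial_deriv j q x + (\<Sum>\<alpha>\<in>P. k \<alpha> * \<alpha> $ j * r \<alpha> x)"
  using assms by (auto simp: dunkl_operator_def reflection_quotient_def intro!: sum.cong)

text \<open>Off the hyperplanes, which form a null set, the Dunkl operator is given by the continuous quotients.  Its values on the
hyperplanes therefore never matter, and the polynomial $u$ makes the integrand measurable.\<close>

lemma dunkl_integration_by_parts:
  assumes q: "real_polynomial_function q"
    and T: "dunkl_operator P k j q = u" and u: "real_polynomial_function u"
  shows "(\<integral>x. (u x * (bump x)\<^sup>2 - 4 * (x $ j * q x) * bump x) * dunkl_weight P k x \<partial>lborel) = 0"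
proof -
  obtain r where contr: "\<And>\<alpha>. continuous_on UNIV (r \<alpha>)"
    and r: "\<And>\<alpha> x. q x - q (reflection \<alpha> x) = (\<alpha> \<bullet> x) * r \<alpha> x"
    using reflection_divided_difference[OF q] by metis
  have [measurable]: "q \<in> borel_measurable borel" "partial_deriv j q \<in> borel_measurable borel"
    "u \<in> borel_measurable borel" "bump \<in> borel_measurable borel" "\<And>\<alpha>. r \<alpha> \<in> borel_measurable borel"
    by (intro borel_measurable_continuous_onI contr continuous_bump continuous_on_real_polynomial_function q u
        real_polynomial_function_partial_deriv)+
  let ?f = "\<lambda>x. ((partial_deriv j q x * (bump x)\<^sup>2 - 4 * (x $ j * q x) * bump x) +
      (\<Sum>\<alpha>\<in>P. k \<alpha> * \<alpha> $ j * r \<alpha> x) * (bump x)\<^sup>2) * dunkl_weight P k x"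
  let ?g = "\<lambda>x. (u x * (bump x)\<^sup>2 - 4 * (x $ j * q x) * bump x) * dunkl_weight P k x"
  have "AE x in lborel. ?g x = ?f x"
    using AE_off_hyperplanes
  proof eventually_elim
    case (elim x)
    show ?case
      unfolding T[symmetric] dunkl_operator_off_hyperplanes[OF elim r, of j]
      by (simp add: algebra_simps)
  qed
  then have "integral\<^sup>L lborel ?g = integral\<^sup>L lborel ?f"
    by (intro integral_cong_AE) measurable
  then show ?thesis using integration_by_parts[OF q contr r] by simp
qed

text \<open>In the difference part, $\sum_j \alpha_j x_j = \langle\alpha,x\rangle$ cancels the denominator.\<close>

lemma dunkl_euler_identity:
  assumes "\<forall>\<alpha>\<in>P. \<alpha> \<bullet> x \<noteq> 0" and q: "q \<in> homogeneous_polynomials n"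
  shows "(\<Sum>j\<in>UNIV. x $ j * dunkl_operator P k j q x) =
    n * q x + (\<Sum>\<alpha>\<in>P. k \<alpha> * (q x - q (reflection \<alpha> x)))"
proof -
  have rq: "real_polynomial_function q" using q by (simp add: homogeneous_polynomials_def)
  obtain r where r: "\<And>\<alpha> x. q x - q (reflection \<alpha> x) = (\<alpha> \<bullet> x) * r \<alpha> x"
    using reflection_divided_difference[OF rq] by metis
  have "(\<Sum>j\<in>UNIV. x $ j * dunkl_operator P k j q x) =
      (\<Sum>j\<in>UNIV. x $ j * partial_deriv j q x) +
      (\<Sum>j\<in>UNIV. \<Sum>\<alpha>\<in>P. k \<alpha> * (\<alpha> $ j * x $ j) * r \<alpha> x)"
    by (simp add: dunkl_operator_off_hyperplanes[OF assms(1) r] distrib_left sum.distrib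
        sum_distrib_left mult_ac)
  also have "(\<Sum>j\<in>UNIV. \<Sum>\<alpha>\<in>P. k \<alpha> * (\<alpha> $ j * x $ j) * r \<alpha> x) =
      (\<Sum>\<alpha>\<in>P. k \<alpha> * ((\<alpha> \<bullet> x) * r \<alpha> x))"
    by (subst sum.swap) (simp add: inner_vec_def sum_distrib_left sum_distrib_right mult_ac)
  finally show ?thesis
    by (simp add: homogeneous_euler_identity[OF q] r)
qed

lemma integral_reflection_difference_eq_0:
  assumes q: "real_polynomial_function q" and a: "a \<in> R"
  shows "integrable lborel (\<lambda>x. (q x - q (reflection a x)) * bump x * dunkl_weight P k x)"
    and "(\<integral>x. (q x - q (reflection a x)) * bump x * dunkl_weight P k x \<partial>lborel) = 0"
proof -
  have contq: "continuous_on UNIV q" by (rule continuous_on_real_polynomial_function[OF q])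
  have contqr: "continuous_on UNIV (\<lambda>x. q (reflection a x))"
    by (intro continuous_on_compose2[OF contq linear_continuous_on[OF bounded_linear_reflection]]) auto
  have i1: "integrable lborel (\<lambda>x. q x * bump x * dunkl_weight P k x)"
    by (rule integrable_times_dunkl_weight[of _ 1])
       (auto intro!: continuous_on_mult contq continuous_bump simp: bump_eq_0)
  have i2: "integrable lborel (\<lambda>x. q (reflection a x) * bump x * dunkl_weight P k x)"
    by (rule integrable_times_dunkl_weight[of _ 1])
       (auto intro!: continuous_on_mult contqr continuous_bump simp: bump_eq_0)
  show "integrable lborel (\<lambda>x. (q x - q (reflection a x)) * bump x * dunkl_weight P k x)"
    using i1 i2 by (simp add: left_diff_distrib)
  have "(\<integral>x. q (reflection a x) * bump x * dunkl_weight P k x \<partial>lborel) =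
      (\<integral>x. q x * bump x * dunkl_weight P k x \<partial>lborel)"
    using integral_reflection[of "\<lambda>x. q x * bump x * dunkl_weight P k x" a] i1 a
    by (simp add: dunkl_weight_reflection integrable_iff_bounded)
  then show "(\<integral>x. (q x - q (reflection a x)) * bump x * dunkl_weight P k x \<partial>lborel) = 0"
    using i1 i2 by (simp add: left_diff_distrib)
qed

end

definition laplacian :: "(real^'n \<Rightarrow> real) \<Rightarrow> real^'n \<Rightarrow> real" where
  "laplacian p = (\<lambda>x. \<Sum>j\<in>UNIV. partial_deriv j (partial_deriv j p) x)"

lemma dunkl_intertwining_homogeneous:
  "dunkl_intertwining P k V \<Longrightarrow> p \<in> homogeneous_polynomials n \<Longrightarrow> V p \<in> homogeneous_polynomials n"
  unfolding dunkl_intertwining_def by blast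

lemma dunkl_intertwining_add:
  "dunkl_intertwining P k V \<Longrightarrow> real_polynomial_function p \<Longrightarrow> real_polynomial_function q \<Longrightarrow>
    V (\<lambda>x. p x + q x) = (\<lambda>x. V p x + V q x)"
  by (simp add: dunkl_intertwining_def)

lemma dunkl_intertwining_cmult:
  "dunkl_intertwining P k V \<Longrightarrow> real_polynomial_function p \<Longrightarrow>
    V (\<lambda>x. c * p x) = (\<lambda>x. c * V p x)"
  by (simp add: dunkl_intertwining_def)

lemma dunkl_intertwining_zero:
  assumes "dunkl_intertwining P k V"
  shows "V (\<lambda>x. 0) = (\<lambda>x. 0)"
proof -
  have "V (\<lambda>x. 0 * 0) = (\<lambda>x. 0 * V (\<lambda>x. 0) x)"
    by (rule dunkl_intertwining_cmult[OF assms]) (rule real_polynomial_function.intros(2))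
  then show ?thesis by simp
qed

lemma dunkl_intertwining_sum:
  assumes V: "dunkl_intertwining P k V"
    and "finite A" "\<And>i. i \<in> A \<Longrightarrow> real_polynomial_function (f i)"
  shows "V (\<lambda>x. \<Sum>i\<in>A. f i x) = (\<lambda>x. \<Sum>i\<in>A. V (f i) x)"
  using assms(2,3)
proof (induction A rule: finite_induct)
  case (insert i A)
  have "V (\<lambda>x. f i x + (\<Sum>i\<in>A. f i x)) = (\<lambda>x. V (f i) x + V (\<lambda>x. \<Sum>i\<in>A. f i x) x)"
    using insert by (intro dunkl_intertwining_add[OF V] real_polynomial_function_sum) auto
  with insert show ?case by simp
qed (simp add: dunkl_intertwining_zero[OF V])

text \<open>With $q = V p$ the intertwining relation gives $T_j q = V \partial_j p$ and
$T_j T_j q = V \partial_j^2 p$; so only values of $V$ on polynomials occur.  Integrating each $T_j(T_j q)$ by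
parts against $b^2$ leaves $4 \sum_j x_j T_j q$ against $b$, and Euler's identity finishes, the differences
$q - q \circ \sigma_\alpha$ having integral zero.\<close>

lemma (in dunkl_setting) dunkl_intertwining_green:
  assumes V: "dunkl_intertwining P k V" and p: "p \<in> homogeneous_polynomials n"
  shows "(\<integral>x. V (laplacian p) x * (bump x)\<^sup>2 * dunkl_weight P k x \<partial>lborel) =
    4 * n * (\<integral>x. V p x * bump x * dunkl_weight P k x \<partial>lborel)"
proof -
  have T: "dunkl_operator P k j (V p) = V (partial_deriv j p)" if "real_polynomial_function p" for j p
    using V that by (simp add: dunkl_intertwining_def)
  have hp: "\<And>p n. p \<in> homogeneous_polynomials n \<Longrightarrow> real_polynomial_function p"
    by (simp add: homogeneous_polynomials_def)
  define q where "q = V p"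
  define d where "d j = V (partial_deriv j p)" for j
  define u where "u j = V (partial_deriv j (partial_deriv j p))" for j
  have q: "q \<in> homogeneous_polynomials n"
    unfolding q_def by (rule dunkl_intertwining_homogeneous[OF V p])
  have d: "real_polynomial_function (d j)" for j
    unfolding d_def by (rule hp[OF dunkl_intertwining_homogeneous[OF V homogeneous_partial_deriv[OF p]]])
  have u: "real_polynomial_function (u j)" for j
    unfolding u_def
    by (rule hp[OF dunkl_intertwining_homogeneous[OF V homogeneous_partial_deriv[OF homogeneous_partial_deriv[OF p]]]])
  have Tq: "dunkl_operator P k j q = d j" for j
    unfolding q_def d_def by (rule T[OF hp[OF p]])
  have Td: "dunkl_operator P k j (d j) = u j" for j
    unfolding d_def u_def by (rule T[OF hp[OF homogeneous_partial_deriv[OF p]]])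
  have Vu: "V (laplacian p) = (\<lambda>x. \<Sum>j\<in>UNIV. u j x)"
    unfolding laplacian_def u_def
    by (rule dunkl_intertwining_sum[OF V]) (auto intro: hp[OF homogeneous_partial_deriv[OF homogeneous_partial_deriv[OF p]]])
  let ?w = "dunkl_weight P k"
  have cont: "continuous_on UNIV q" "continuous_on UNIV (d j)" "continuous_on UNIV (u j)" for j
    by (rule continuous_on_real_polynomial_function, rule hp[OF q] d u)+
  have iu: "integrable lborel (\<lambda>x. u j x * (bump x)\<^sup>2 * ?w x)" for j
    by (rule integrable_times_dunkl_weight[of _ 1])
       (auto intro!: continuous_on_mult continuous_on_power cont continuous_bump simp: bump_eq_0)
  have id: "integrable lborel (\<lambda>x. (x $ j * d j x) * bump x * ?w x)" for j
    by (rule integrable_times_dunkl_weight[of _ 1])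
       (auto intro!: continuous_on_mult continuous_on_component continuous_on_id cont continuous_bump simp: bump_eq_0)
  have iq: "integrable lborel (\<lambda>x. q x * bump x * ?w x)"
    by (rule integrable_times_dunkl_weight[of _ 1])
       (auto intro!: continuous_on_mult cont continuous_bump simp: bump_eq_0)
  have "(\<integral>x. V (laplacian p) x * (bump x)\<^sup>2 * ?w x \<partial>lborel) =
      (\<Sum>j\<in>UNIV. \<integral>x. u j x * (bump x)\<^sup>2 * ?w x \<partial>lborel)"
    unfolding Vu sum_distrib_right by (rule Bochner_Integration.integral_sum) (rule iu)
  also have "\<dots> = (\<Sum>j\<in>UNIV. 4 * (\<integral>x. (x $ j * d j x) * bump x * ?w x \<partial>lborel))"
  proof (rule sum.cong[OF refl])
    fix j
    have "(\<integral>x. u j x * (bump x)\<^sup>2 * ?w x - 4 * ((x $ j * d j x) * bump x * ?w x) \<partial>lborel) = 0"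
      using dunkl_integration_by_parts[OF d Td u, of j] by (simp add: algebra_simps)
    then show "(\<integral>x. u j x * (bump x)\<^sup>2 * ?w x \<partial>lborel) = 4 * (\<integral>x. (x $ j * d j x) * bump x * ?w x \<partial>lborel)"
      using iu id by simp
  qed
  also have "\<dots> = 4 * (\<integral>x. (\<Sum>j\<in>UNIV. x $ j * d j x) * bump x * ?w x \<partial>lborel)"
    unfolding sum_distrib_right by (subst Bochner_Integration.integral_sum) (auto intro: id simp: sum_distrib_left)
  also have "(\<integral>x. (\<Sum>j\<in>UNIV. x $ j * d j x) * bump x * ?w x \<partial>lborel) =
      (\<integral>x. n * (q x * bump x * ?w x) +
        (\<Sum>\<alpha>\<in>P. k \<alpha> * ((q x - q (reflection \<alpha> x)) * bump x * ?w x)) \<partial>lborel)"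
  proof (rule integral_cong_AE)
    have [measurable]: "q \<in> borel_measurable borel" "\<And>j. d j \<in> borel_measurable borel"
      "bump \<in> borel_measurable borel"
      by (intro borel_measurable_continuous_onI cont continuous_bump)+
    show "(\<lambda>x. (\<Sum>j\<in>UNIV. x $ j * d j x) * bump x * ?w x) \<in> borel_measurable lborel"
      by measurable
    show "(\<lambda>x. n * (q x * bump x * ?w x) +
        (\<Sum>\<alpha>\<in>P. k \<alpha> * ((q x - q (reflection \<alpha> x)) * bump x * ?w x))) \<in> borel_measurable lborel"
      by measurable
    show "AE x in lborel. (\<Sum>j\<in>UNIV. x $ j * d j x) * bump x * ?w x =
      n * (q x * bump x * ?w x) + (\<Sum>\<alpha>\<in>P. k \<alpha> * ((q x - q (reflection \<alpha> x)) * bump x * ?w x))"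
      using AE_off_hyperplanes
    proof eventually_elim
      case (elim x)
      have "(\<Sum>\<alpha>\<in>P. k \<alpha> * ((q x - q (reflection \<alpha> x)) * bump x * ?w x)) =
          (\<Sum>\<alpha>\<in>P. k \<alpha> * (q x - q (reflection \<alpha> x))) * bump x * ?w x"
        by (simp add: sum_distrib_right mult.assoc)
      then show ?case
        using dunkl_euler_identity[OF elim q] by (simp add: Tq distrib_right)
    qed
  qed
  also have "\<dots> = n * (\<integral>x. q x * bump x * ?w x \<partial>lborel)"
  proof -
    note z = integral_reflection_difference_eq_0[OF hp[OF q], OF subsetD[OF P_subset]]
    have "(\<integral>x. n * (q x * bump x * ?w x) +
        (\<Sum>\<alpha>\<in>P. k \<alpha> * ((q x - q (reflection \<alpha> x)) * bump x * ?w x)) \<partial>lborel) =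
      n * (\<integral>x. q x * bump x * ?w x \<partial>lborel) +
        (\<Sum>\<alpha>\<in>P. k \<alpha> * (\<integral>x. (q x - q (reflection \<alpha> x)) * bump x * ?w x \<partial>lborel))"
      by (subst Bochner_Integration.integral_add, (auto intro!: iq z(1))[2],
          subst Bochner_Integration.integral_sum) (auto intro: z(1))
    also have "\<dots> = n * (\<integral>x. q x * bump x * ?w x \<partial>lborel)"
      by (simp add: z(2))
    finally show ?thesis .
  qed
  finally show ?thesis by (simp add: q_def)
qed

section \<open>Surface measure and polar coordinates\<close>

lemma cball_measurable [measurable]: "cball a r \<in> sets borel"
  by (rule borel_closed) simp

text \<open>As a density, the surface measure is accessible to the rules for Bochner integrals.\<close>

lemma surface_measure_eq_density:
  "(surface_measure :: (real^'n) measure) =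
    density (distr (restrict_space lborel (ball 0 1 - {0})) (restrict_space borel (sphere 0 1))
      (\<lambda>x. x /\<^sub>R norm x)) (\<lambda>_. ennreal (real CARD('n)))"
  by (rule measure_eqI)
     (simp_all add: surface_measure_def emeasure_density nn_integral_cmult ennreal_of_nat_eq_real_of_nat)

lemma normalize_measurable [measurable]:
  "(\<lambda>x::real^'n. x /\<^sub>R norm x) \<in>
    measurable (restrict_space lborel (ball 0 1 - {0})) (restrict_space borel (sphere 0 1))"
  by (rule measurable_restrict_space2) (auto simp: space_restrict_space intro!: measurable_restrict_space1)

lemma space_surface_measure [simp]: "space surface_measure = sphere 0 1"
  by (simp add: surface_measure_eq_density space_restrict_space)

lemma sets_surface_measure [simp, measurable_cong]:
  "sets surface_measure = sets (restrict_space borel (sphere 0 1))"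
  by (simp add: surface_measure_eq_density)

lemma finite_measure_surface_measure: "finite_measure (surface_measure :: (real^'n) measure)"
proof (rule finite_measureI)
  let ?N = "restrict_space lborel (ball (0::real^'n) 1 - {0})"
  have "emeasure ?N (space ?N) \<le> emeasure lborel (ball (0::real^'n) 1)"
    by (simp add: emeasure_restrict_space space_restrict_space emeasure_mono)
  then have "emeasure ?N (space ?N) < \<infinity>"
    using emeasure_lborel_ball_finite le_less_trans by blast
  moreover have "emeasure surface_measure (space (surface_measure :: (real^'n) measure)) =
      of_nat CARD('n) * emeasure ?N (space ?N)"
  proof -
    have "emeasure (distr ?N (restrict_space borel (sphere 0 1)) (\<lambda>x. x /\<^sub>R norm x))
        (space (restrict_space borel (sphere 0 1))) = emeasure ?N (space ?N)"
      by (subst emeasure_distr[OF normalize_measurable sets.top])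
         (auto simp: space_restrict_space intro!: arg_cong2[of _ _ _ _ emeasure])
    then show ?thesis by (simp add: surface_measure_def space_scale_measure)
  qed
  ultimately show "emeasure surface_measure (space (surface_measure :: (real^'n) measure)) \<noteq> \<infinity>"
    by (simp add: ennreal_mult_eq_top_iff less_top[symmetric])
qed

lemma integrable_surface_measure:
  fixes f :: "real^'n \<Rightarrow> real"
  assumes "f \<in> borel_measurable (restrict_space borel (sphere 0 1))" "\<And>x. norm x = 1 \<Longrightarrow> \<bar>f x\<bar> \<le> C"
  shows "integrable surface_measure f"
proof -
  interpret finite_measure "surface_measure :: (real^'n) measure"
    by (rule finite_measure_surface_measure)
  show ?thesis
    using assms by (intro integrable_const_bound[of f C] AE_I2) (auto cong: measurable_cong_sets)
qed

lemma AE_lborel_ball_iff_cball: "AE x in lborel. x \<in> ball (0::real^'n) 1 - {0} \<longleftrightarrow> x \<in> cball 0 1"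
proof -
  have "negligible (sphere (0::real^'n) 1)" by (rule negligible_sphere)
  then have "sphere (0::real^'n) 1 \<in> null_sets lborel"
    by (auto simp: negligible_iff_null_sets null_sets_completion_iff)
  from AE_not_in[OF this] AE_lborel_singleton[of "0::real^'n"] show ?thesis
    by eventually_elim auto
qed

lemma integral_surface_measure:
  fixes f :: "real^'n \<Rightarrow> real"
  assumes [measurable]: "f \<in> borel_measurable borel"
  shows "(\<integral>\<xi>. f \<xi> \<partial>surface_measure) =
    real CARD('n) * (\<integral>x. indicator (cball 0 1) x * f (x /\<^sub>R norm x) \<partial>lborel)"
proof -
  let ?N = "restrict_space lborel (ball (0::real^'n) 1 - {0})"
  let ?n = "\<lambda>x::real^'n. x /\<^sub>R norm x"
  have [measurable]: "ball (0::real^'n) 1 - {0} \<in> sets borel"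
    by (intro borel_open open_Diff) auto
  have fm: "f \<in> borel_measurable (restrict_space borel (sphere 0 1))"
    by (rule measurable_restrict_space1) measurable
  have "(\<integral>\<xi>. f \<xi> \<partial>surface_measure) =
      (\<integral>\<xi>. real CARD('n) *\<^sub>R f \<xi> \<partial>distr ?N (restrict_space borel (sphere 0 1)) ?n)"
    unfolding surface_measure_eq_density using fm by (subst integral_density) auto
  also have "\<dots> = real CARD('n) * (\<integral>x. f (?n x) \<partial>?N)"
    using fm by (subst integral_distr[OF normalize_measurable]) auto
  also have "(\<integral>x. f (?n x) \<partial>?N) = (\<integral>x. indicator (ball 0 1 - {0}) x *\<^sub>R f (?n x) \<partial>lborel)"
    by (rule integral_restrict_space) auto
  also have "\<dots> = (\<integral>x. indicator (cball 0 1) x * f (?n x) \<partial>lborel)"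
  proof (rule integral_cong_AE)
    show "AE x in lborel. indicator (ball 0 1 - {0}) x *\<^sub>R f (?n x) = indicator (cball 0 1) x * f (?n x)"
      using AE_lborel_ball_iff_cball by eventually_elim (auto simp: indicator_def)
  qed measurable
  finally show ?thesis .
qed

lemma integral_lborel_scale:
  fixes f :: "real^'n \<Rightarrow> real"
  assumes [measurable]: "f \<in> borel_measurable borel" and c: "c > 0"
  shows "(\<integral>x. f x \<partial>lborel) = c ^ CARD('n) * (\<integral>x. f (c *\<^sub>R x) \<partial>lborel)"
proof -
  have "(\<integral>x. f x \<partial>lborel) = (\<integral>x. f x \<partial>density (distr lborel borel (\<lambda>x. 0 + c *\<^sub>R x)) (\<lambda>_. \<bar>c\<bar> ^ DIM(real^'n)))"
    using c by (subst lborel_affine[of c 0]) auto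
  also have "\<dots> = c ^ CARD('n) * (\<integral>x. f (c *\<^sub>R x) \<partial>lborel)"
    using c by (subst integral_density) (auto simp: integral_distr)
  finally show ?thesis .
qed

lemma powr_nn_integral:
  assumes p: "p > (0::real)" and r: "0 \<le> r" "r \<le> 1"
  shows "(\<integral>\<^sup>+s. ennreal (s powr (p - 1)) * indicator {r..1} s \<partial>lborel) = ennreal ((1 - r powr p) / p)"
proof (rule nn_integral_has_integral_lebesgue')
  have "((\<lambda>s. s powr (p - 1)) has_integral (1 powr p / p - r powr p / p)) {r..1}"
  proof (rule fundamental_theorem_of_calculus_interior)
    show "continuous_on {r..1} (\<lambda>s. s powr p / p)"
      using p r by (intro continuous_on_divide continuous_on_powr' continuous_on_id continuous_on_const) auto
    show "((\<lambda>s. s powr p / p) has_vector_derivative s powr (p - 1)) (at s)" if "s \<in> {r<..<1}" for s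
    proof -
      have "((\<lambda>s. s powr p / p) has_real_derivative (p * s powr (p - 1)) / p) (at s)"
        using that r by (intro DERIV_cdivide has_real_derivative_powr) auto
      then show ?thesis using p by (simp add: has_real_derivative_iff_has_vector_derivative)
    qed
  qed (use r in auto)
  then show "((\<lambda>s. s powr (p - 1)) has_integral ((1 - r powr p) / p)) {r..1}"
    by (simp add: diff_divide_distrib)
qed auto

text \<open>Scaling shows that the part of the ball with $|x|^2 \le r$ carries $r^{d/2}$ of the total mass $m$ of a density that
is constant along rays.  So $|x|^2$ is distributed with density $m \frac d2 s^{d/2 - 1}$ on the unit interval.
The squared norm, rather than the norm, is used as the radial variable because it leads directly to beta integrals.\<close>

lemma polar_coordinates_measure:
  fixes F :: "real^'n \<Rightarrow> real"
  assumes [measurable]: "F \<in> borel_measurable borel"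
    and F: "\<And>x. 0 \<le> F x" "\<And>x. F x \<le> C"
  defines "m \<equiv> (\<integral>x. indicator (cball 0 1) x * F (x /\<^sub>R norm x) \<partial>lborel)"
    and "p \<equiv> real CARD('n) / 2"
  shows "distr (density lborel (\<lambda>x. ennreal (indicator (cball 0 1) x * F (x /\<^sub>R norm x)))) borel (\<lambda>x. (norm x)\<^sup>2)
    = density lborel (\<lambda>s. ennreal (indicator {0..1} s * (m * p * s powr (p - 1))))" (is "?M = ?N")
proof -
  let ?\<Phi> = "\<lambda>x. F (x /\<^sub>R norm x)"
  have p: "p > 0" by (simp add: p_def)
  have int: "integrable lborel (\<lambda>x. indicator A x * (indicator (cball 0 1) x * ?\<Phi> x))" if [measurable]: "A \<in> sets borel" for A
  proof (rule Bochner_Integration.integrable_bound)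
    show "integrable lborel (\<lambda>x. indicator (cball (0::real^'n) 1) x * C)"
      by (intro integrable_mult_left integrable_real_indicator)
        (use emeasure_lborel_cball_finite[of "0::real^'n" 1] in auto)
    show "AE x in lborel. norm (indicator A x * (indicator (cball 0 1) x * ?\<Phi> x)) \<le> norm (indicator (cball 0 1) x * C)"
      using F order_trans[OF F] by (auto simp: indicator_def abs_mult)
  qed measurable
  define J where "J A = (\<integral>x. indicator A x * (indicator (cball 0 1) x * ?\<Phi> x) \<partial>lborel)" for A
  have M: "emeasure ?M {r<..} = ennreal (J {x. (norm x)\<^sup>2 > r})" for r
  proof -
    have S [measurable]: "{x. (norm (x::real^'n))\<^sup>2 > r} \<in> sets borel" by measurable
    note int = int[OF this]
    have vim: "(\<lambda>x::real^'n. (norm x)\<^sup>2) -` {r<..} = {x. (norm x)\<^sup>2 > r}" by auto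
    have "emeasure ?M {r<..} = (\<integral>\<^sup>+x. ennreal (indicator {x. (norm x)\<^sup>2 > r} x * (indicator (cball 0 1) x * ?\<Phi> x)) \<partial>lborel)"
      by (subst emeasure_distr, measurable, subst emeasure_density)
         (auto intro!: nn_integral_cong simp: indicator_def vim S)
    also have "\<dots> = ennreal (J {x. (norm x)\<^sup>2 > r})"
      unfolding J_def by (rule nn_integral_eq_integral[OF int]) (auto simp: F)
    finally show ?thesis .
  qed
  have m0: "m \<ge> 0" unfolding m_def by (intro Bochner_Integration.integral_nonneg) (simp add: F)
  have N: "emeasure ?N {r<..} = ennreal (m * (1 - r powr p))" if "0 \<le> r" "r \<le> 1" for r
  proof -
    have "emeasure ?N {r<..} = (\<integral>\<^sup>+s. ennreal (m * p) * (ennreal (s powr (p - 1)) * indicator {r..1} s) \<partial>lborel)"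
    proof (subst emeasure_density, measurable, rule nn_integral_cong_AE)
      show "AE s in lborel. ennreal (indicator {0..1} s * (m * p * s powr (p - 1))) * indicator {r<..} s =
          ennreal (m * p) * (ennreal (s powr (p - 1)) * indicator {r..1} s)"
        using AE_lborel_singleton[of r]
        by eventually_elim (use that p m0 in \<open>auto simp: indicator_def ennreal_mult'\<close>)
    qed
    also have "\<dots> = ennreal (m * p) * ennreal ((1 - r powr p) / p)"
      by (subst nn_integral_cmult) (simp_all add: powr_nn_integral[OF p that])
    also have "\<dots> = ennreal (m * (1 - r powr p))"
      using p m0 that powr_le1[of p r] by (simp add: ennreal_mult'' [symmetric])
    finally show ?thesis .
  qed
  have "emeasure ?M {r<..} = emeasure ?N {r<..}" for r
  proof -
    consider "r < 0" | "0 \<le> r" "r \<le> 1" | "r > 1" by linarith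
    then show ?thesis
    proof cases
      case 1
      have "emeasure ?N {r<..} = emeasure ?N {0<..}"
      proof (subst (1 2) emeasure_density)
        show "(\<integral>\<^sup>+ s. ennreal (indicator {0..1} s * (m * p * s powr (p - 1))) * indicator {r<..} s \<partial>lborel) =
          (\<integral>\<^sup>+ s. ennreal (indicator {0..1} s * (m * p * s powr (p - 1))) * indicator {0<..} s \<partial>lborel)"
          using AE_lborel_singleton[of "0::real"]
          by (intro nn_integral_cong_AE) (eventually_elim, use 1 in \<open>auto simp: indicator_def\<close>)
      qed measurable
      also have "\<dots> = ennreal m" using N[of 0] by simp
      finally have "emeasure ?N {r<..} = ennreal m" .
      moreover have "m = J {x. (norm x)\<^sup>2 > r}"
      proof -
        have "{x::real^'n. (norm x)\<^sup>2 > r} = UNIV"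
          using 1 zero_le_power2 less_le_trans by blast
        then show ?thesis by (simp add: J_def m_def)
      qed
      ultimately show ?thesis by (simp only: M)
    next
      case 2
      have "J {x. (norm x)\<^sup>2 > r} = m - J {x. (norm x)\<^sup>2 \<le> r}"
      proof -
        have "J {x. (norm x)\<^sup>2 > r} + J {x. (norm x)\<^sup>2 \<le> r} =
          (\<integral>x. indicator {x. (norm x)\<^sup>2 > r} x * (indicator (cball 0 1) x * ?\<Phi> x) +
             indicator {x. (norm x)\<^sup>2 \<le> r} x * (indicator (cball 0 1) x * ?\<Phi> x) \<partial>lborel)"
          unfolding J_def by (rule Bochner_Integration.integral_add[symmetric]; rule int; measurable)
        also have "\<dots> = m"
          unfolding m_def by (intro Bochner_Integration.integral_cong) (auto simp: indicator_def)
        finally show ?thesis by simp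
      qed
      also have "J {x. (norm x)\<^sup>2 \<le> r} = m * r powr p"
      proof (cases "r = 0")
        case True
        have "J {x. (norm x)\<^sup>2 \<le> r} = (\<integral>x. 0 \<partial>(lborel :: (real^'n) measure))"
          unfolding J_def
        proof (rule integral_cong_AE)
          show "AE x in lborel. indicator {x. (norm x)\<^sup>2 \<le> r} x * (indicator (cball 0 1) x * ?\<Phi> x) = 0"
            using AE_lborel_singleton[of "0::real^'n"] by eventually_elim (use True in \<open>auto simp: indicator_def\<close>)
        qed measurable
        then show ?thesis using True p by simp
      next
        case False
        then have r: "r > 0" "sqrt r > 0" using 2 by auto
        have "J {x. (norm x)\<^sup>2 \<le> r} = sqrt r ^ CARD('n) *
          (\<integral>x. indicator {x. (norm x)\<^sup>2 \<le> r} (sqrt r *\<^sub>R x) * (indicator (cball 0 1) (sqrt r *\<^sub>R x) * ?\<Phi> (sqrt r *\<^sub>R x)) \<partial>lborel)"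
          unfolding J_def by (rule integral_lborel_scale[OF _ r(2)]) measurable
        also have "(\<lambda>x. indicator {x. (norm x)\<^sup>2 \<le> r} (sqrt r *\<^sub>R x) * (indicator (cball 0 1) (sqrt r *\<^sub>R x) * ?\<Phi> (sqrt r *\<^sub>R x))) =
          (\<lambda>x. indicator (cball 0 1) x * ?\<Phi> x)"
        proof
          fix x :: "real^'n"
          have a: "(norm (sqrt r *\<^sub>R x))\<^sup>2 \<le> r \<longleftrightarrow> norm x \<le> 1"
            using r by (simp add: power_mult_distrib power_le_one_iff)
          have b: "norm (sqrt r *\<^sub>R x) \<le> 1" if "norm x \<le> 1"
            using 2 r that by (simp add: mult_le_one)
          have c: "(sqrt r *\<^sub>R x) /\<^sub>R norm (sqrt r *\<^sub>R x) = x /\<^sub>R norm x"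
            using r by simp
          show "indicator {x. (norm x)\<^sup>2 \<le> r} (sqrt r *\<^sub>R x) * (indicator (cball 0 1) (sqrt r *\<^sub>R x) * ?\<Phi> (sqrt r *\<^sub>R x)) =
            indicator (cball 0 1) x * ?\<Phi> x"
            unfolding c using a b by (auto simp: indicator_def simp del: norm_scaleR)
        qed
        also have "sqrt r ^ CARD('n) = r powr p"
          using r by (simp add: p_def powr_half_sqrt[symmetric] powr_powr powr_realpow[symmetric])
        finally show ?thesis by (simp add: m_def mult.commute)
      qed
      finally have "J {x. (norm x)\<^sup>2 > r} = m * (1 - r powr p)" by (simp add: right_diff_distrib)
      then show ?thesis by (simp only: M N[OF 2])
    next
      case 3
      have z: "indicator {x. (norm x)\<^sup>2 > r} x * indicator (cball 0 1) x = (0::real)" for x :: "real^'n"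
        using 3 power_le_one[of "norm x" 2] by (auto simp: indicator_def)
      then have "J {x. (norm x)\<^sup>2 > r} = 0"
        unfolding J_def mult.assoc[symmetric] z by simp
      moreover have "emeasure ?N {r<..} = 0"
      proof -
        have z: "ennreal (indicator {0..1} s * (m * p * s powr (p - 1))) * indicator {r<..} s = 0" for s
          using 3 by (auto simp: indicator_def)
        show ?thesis by (subst emeasure_density, measurable) (simp only: z nn_integral_const mult_zero_left)
      qed
      ultimately show ?thesis by (simp add: M)
    qed
  qed
  moreover have "emeasure ?M {r<..} < \<infinity>" for r
    by (simp only: M ennreal_less_top infinity_ennreal_def)
  ultimately show ?thesis
    by (intro measure_eqI_lessThan) simp_all
qed

lemma polar_coordinates_nonneg:
  fixes F :: "real^'n \<Rightarrow> real" and \<phi> :: "real \<Rightarrow> real"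
  defines "p \<equiv> real CARD('n) / 2"
  assumes [measurable]: "F \<in> borel_measurable borel" "\<phi> \<in> borel_measurable borel"
    and F: "\<And>x. 0 \<le> F x" "\<And>x. F x \<le> C"
    and \<phi>: "has_bochner_integral lborel (\<lambda>s. indicator {0..1} s * (s powr (p - 1) * \<phi> s)) I"
  shows "has_bochner_integral lborel (\<lambda>x. indicator (cball 0 1) x * F (x /\<^sub>R norm x) * \<phi> ((norm x)\<^sup>2))
    (p * I * (\<integral>x. indicator (cball 0 1) x * F (x /\<^sub>R norm x) \<partial>lborel))"
proof -
  let ?m = "\<integral>x. indicator (cball 0 1) x * F (x /\<^sub>R norm x) \<partial>lborel"
  let ?M = "distr (density lborel (\<lambda>x. ennreal (indicator (cball 0 1) x * F (x /\<^sub>R norm x)))) borel (\<lambda>x. (norm x)\<^sup>2)"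
  let ?N = "density lborel (\<lambda>s. ennreal (indicator {0..1} s * (?m * p * s powr (p - 1))))"
  have MN: "?M = ?N"
    unfolding p_def by (rule polar_coordinates_measure[OF _ F]) measurable
  have m0: "?m \<ge> 0" by (intro Bochner_Integration.integral_nonneg) (simp add: F)
  have p0: "p \<ge> 0" by (simp add: p_def)
  have "has_bochner_integral lborel (\<lambda>s. ?m * p * (indicator {0..1} s * (s powr (p - 1) * \<phi> s))) (?m * p * I)"
    by (rule has_bochner_integral_mult_right) (rule \<phi>)
  then have "has_bochner_integral lborel (\<lambda>s. (indicator {0..1} s * (?m * p * s powr (p - 1))) *\<^sub>R \<phi> s) (?m * p * I)"
    by (simp add: mult_ac)
  then have "has_bochner_integral ?N \<phi> (?m * p * I)"
    using m0 p0 by (intro has_bochner_integral_density) auto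
  then have "has_bochner_integral ?M \<phi> (?m * p * I)" by (simp only: MN)
  then have "integrable lborel (\<lambda>x. (indicator (cball 0 1) x * F (x /\<^sub>R norm x)) *\<^sub>R \<phi> ((norm x)\<^sup>2))"
    "(\<integral>x. (indicator (cball 0 1) x * F (x /\<^sub>R norm x)) *\<^sub>R \<phi> ((norm x)\<^sup>2) \<partial>lborel) = ?m * p * I"
    by (simp_all add: has_bochner_integral_iff integrable_distr_eq integral_distr integrable_density integral_density F)
  then show ?thesis by (simp add: has_bochner_integral_iff mult_ac)
qed

text \<open>The signed case follows from the nonnegative one for $F + C$ and for the constant $C$.\<close>

lemma polar_coordinates:
  fixes F :: "real^'n \<Rightarrow> real" and \<phi> :: "real \<Rightarrow> real"
  defines "p \<equiv> real CARD('n) / 2"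
  assumes Fm [measurable]: "F \<in> borel_measurable borel" and \<phi>m [measurable]: "\<phi> \<in> borel_measurable borel"
    and F: "\<And>x. \<bar>F x\<bar> \<le> C"
    and \<phi>: "has_bochner_integral lborel (\<lambda>s. indicator {0..1} s * (s powr (p - 1) * \<phi> s)) I"
  shows "has_bochner_integral lborel (\<lambda>x. indicator (cball 0 1) x * F (x /\<^sub>R norm x) * \<phi> ((norm x)\<^sup>2))
    (I / 2 * (\<integral>\<xi>. F \<xi> \<partial>surface_measure))"
proof -
  let ?n = "\<lambda>x::real^'n. x /\<^sub>R norm x"
  let ?i = "\<lambda>x::real^'n. indicator (cball 0 1) x :: real"
  have C: "C \<ge> 0" using F[of 0] by linarith
  have FC: "0 \<le> F x + C" "F x + C \<le> 2 * C" for x using F[of x] by linarith+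
  have A: "has_bochner_integral lborel (\<lambda>x. ?i x * (F (?n x) + C) * \<phi> ((norm x)\<^sup>2))
      (p * I * (\<integral>x. ?i x * (F (?n x) + C) \<partial>lborel))"
    unfolding p_def
    by (rule polar_coordinates_nonneg[of "\<lambda>x. F x + C" \<phi> "2 * C"])
       (use FC \<phi> in \<open>auto simp: p_def\<close>)
  have B: "has_bochner_integral lborel (\<lambda>x. ?i x * C * \<phi> ((norm x)\<^sup>2))
      (p * I * (\<integral>x. ?i x * C \<partial>lborel))"
    unfolding p_def
    by (rule polar_coordinates_nonneg[of "\<lambda>x. C" \<phi> C]) (use C \<phi> in \<open>auto simp: p_def\<close>)
  have intC: "integrable lborel (\<lambda>x. ?i x * C)"
    by (intro integrable_mult_left integrable_real_indicator)
       (use emeasure_lborel_cball_finite[of "0::real^'n" 1] in auto)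
  have intF: "integrable lborel (\<lambda>x. ?i x * F (?n x))"
  proof (rule Bochner_Integration.integrable_bound[OF intC])
    show "AE x in lborel. norm (?i x * F (?n x)) \<le> norm (?i x * C)"
      using F C by (auto simp: indicator_def)
  qed measurable
  have "has_bochner_integral lborel (\<lambda>x. ?i x * (F (?n x) + C) * \<phi> ((norm x)\<^sup>2) - ?i x * C * \<phi> ((norm x)\<^sup>2))
    (p * I * (\<integral>x. ?i x * (F (?n x) + C) \<partial>lborel) - p * I * (\<integral>x. ?i x * C \<partial>lborel))"
    by (rule has_bochner_integral_diff[OF A B])
  moreover have "p * I * (\<integral>x. ?i x * (F (?n x) + C) \<partial>lborel) - p * I * (\<integral>x. ?i x * C \<partial>lborel) =
      p * I * (\<integral>x. ?i x * F (?n x) \<partial>lborel)"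
    using intC intF by (simp add: distrib_left)
  moreover have "\<dots> = I / 2 * (\<integral>\<xi>. F \<xi> \<partial>surface_measure)"
    by (simp add: integral_surface_measure p_def)
  moreover have "?i x * (F (?n x) + C) * \<phi> ((norm x)\<^sup>2) - ?i x * C * \<phi> ((norm x)\<^sup>2) =
      ?i x * F (?n x) * \<phi> ((norm x)\<^sup>2)" for x
    by (simp only: left_diff_distrib[symmetric] right_diff_distrib[symmetric] add_diff_cancel_right')
  ultimately show ?thesis by (simp only:)
qed

lemma has_bochner_integral_Beta:
  assumes "a > 0" "b > (0::real)"
  shows "has_bochner_integral lborel (\<lambda>t. indicator {0..1} t * (t powr (a - 1) * (1 - t) powr (b - 1))) (Beta a b)"
proof (rule has_bochner_integral_nn_integral)
  have "Beta a b > 0" using assms by (simp add: Beta_def)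
  then show "Beta a b \<ge> 0" by simp
  show "(\<integral>\<^sup>+t. ennreal (indicator {0..1} t * (t powr (a - 1) * (1 - t) powr (b - 1))) \<partial>lborel) = ennreal (Beta a b)"
    by (rule nn_integral_has_integral_lebesgue) (auto intro: has_integral_Beta_real assms)
qed auto

text \<open>On the ball $G(x) = (|x|^2)^{m/2}\,G(x/|x|)$, so the radial integral is
$\int_0^1 s^{(m+d)/2 - 1} (1 - s)^{b - 1}\,ds$.\<close>

lemma homogeneous_ball_integral:
  fixes G :: "real^'n \<Rightarrow> real"
  assumes [measurable]: "G \<in> borel_measurable borel"
    and hom: "\<And>c x. c > 0 \<Longrightarrow> G (c *\<^sub>R x) = c powr m * G x"
    and bound: "\<And>x. norm x = 1 \<Longrightarrow> \<bar>G x\<bar> \<le> C"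
    and pos: "m + real CARD('n) > 0" "b > 0"
  shows "has_bochner_integral lborel (\<lambda>x. indicator (cball 0 1) x * (G x * (1 - (norm x)\<^sup>2) powr (b - 1)))
    (Beta ((m + real CARD('n)) / 2) b / 2 * (\<integral>\<xi>. G \<xi> \<partial>surface_measure))"
proof -
  define F where "F x = indicator (sphere 0 1) x * G x" for x
  define \<phi> where "\<phi> s = s powr (m / 2) * (1 - s) powr (b - 1)" for s :: real
  have [measurable]: "sphere (0::real^'n) 1 \<in> sets borel" by (rule borel_closed) simp
  have [measurable]: "F \<in> borel_measurable borel" unfolding F_def by measurable
  have [measurable]: "\<phi> \<in> borel_measurable borel" unfolding \<phi>_def by measurable
  have F: "\<bar>F x\<bar> \<le> max 0 C" for x using bound[of x] by (auto simp: F_def indicator_def)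
  have eq: "(\<integral>\<xi>. F \<xi> \<partial>surface_measure) = (\<integral>\<xi>. G \<xi> \<partial>surface_measure)"
    by (intro Bochner_Integration.integral_cong) (auto simp: F_def)
  have \<phi>: "has_bochner_integral lborel (\<lambda>s. indicator {0..1} s * (s powr (real CARD('n) / 2 - 1) * \<phi> s))
      (Beta ((m + real CARD('n)) / 2) b)"
  proof -
    have "(\<lambda>s. indicator {0..1} s * (s powr (real CARD('n) / 2 - 1) * \<phi> s)) =
        (\<lambda>t. indicator {0..1} t * (t powr ((m + real CARD('n)) / 2 - 1) * (1 - t) powr (b - 1)))"
    proof
      fix s :: real
      have e: "(m + real CARD('n)) / 2 - 1 = (real CARD('n) / 2 - 1) + m / 2"
        by (simp add: add_divide_distrib)
      show "indicator {0..1} s * (s powr (real CARD('n) / 2 - 1) * \<phi> s) =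
        indicator {0..1} s * (s powr ((m + real CARD('n)) / 2 - 1) * (1 - s) powr (b - 1))"
        unfolding e powr_add \<phi>_def by (simp only: mult.assoc)
    qed
    then show ?thesis using has_bochner_integral_Beta[of "(m + real CARD('n)) / 2" b] pos by simp
  qed
  have "has_bochner_integral lborel (\<lambda>x. indicator (cball 0 1) x * F (x /\<^sub>R norm x) * \<phi> ((norm x)\<^sup>2))
      (Beta ((m + real CARD('n)) / 2) b / 2 * (\<integral>\<xi>. F \<xi> \<partial>surface_measure))"
    by (rule polar_coordinates[OF _ _ F \<phi>]) measurable
  then show ?thesis
    unfolding eq
  proof (subst has_bochner_integral_cong_AE)
    show "AE x in lborel. indicator (cball 0 1) x * (G x * (1 - (norm x)\<^sup>2) powr (b - 1)) =
       indicator (cball 0 1) x * F (x /\<^sub>R norm x) * \<phi> ((norm x)\<^sup>2)"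
      using AE_lborel_singleton[of "0::real^'n"]
    proof eventually_elim
      case (elim x)
      have "G x = G (norm x *\<^sub>R (x /\<^sub>R norm x))" using elim by simp
      also have "\<dots> = norm x powr m * G (x /\<^sub>R norm x)" using elim by (intro hom) simp
      also have "norm x powr m = ((norm x)\<^sup>2) powr (m / 2)"
        using elim powr_powr[of "norm x" 2 "m / 2"] by (simp add: powr_numeral)
      finally have "G x = ((norm x)\<^sup>2) powr (m / 2) * F (x /\<^sub>R norm x)"
        using elim by (simp add: F_def)
      then show ?case by (simp add: \<phi>_def mult_ac)
    qed
  qed measurable
qed

section \<open>Sphere integrals and the Laplacian\<close>

lemma pos_not_in_nonpos_Ints: "(x::real) > 0 \<Longrightarrow> x \<notin> \<int>\<^sub>\<le>\<^sub>0"
  by (auto elim!: nonpos_Ints_cases)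

lemma dunkl_weight_scale:
  assumes "finite P" "c > 0"
  shows "dunkl_weight P k (c *\<^sub>R x) = c powr (2 * dunkl_gamma P k) * dunkl_weight P k x"
proof -
  have "dunkl_weight P k (c *\<^sub>R x) = (\<Prod>\<alpha>\<in>P. c powr (2 * k \<alpha>) * \<bar>\<alpha> \<bullet> x\<bar> powr (2 * k \<alpha>))"
    using assms(2) by (simp add: dunkl_weight_def abs_mult powr_mult)
  also have "\<dots> = (\<Prod>\<alpha>\<in>P. c powr (2 * k \<alpha>)) * dunkl_weight P k x"
    by (simp add: prod.distrib dunkl_weight_def)
  also have "(\<Prod>\<alpha>\<in>P. c powr (2 * k \<alpha>)) = c powr (2 * dunkl_gamma P k)"
    using assms by (simp add: powr_sum dunkl_gamma_def sum_distrib_left)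
  finally show ?thesis .
qed

lemma laplacian_homogeneous:
  assumes "p \<in> homogeneous_polynomials n"
  shows "laplacian p \<in> homogeneous_polynomials (n - 2)"
proof -
  have d: "partial_deriv j (partial_deriv j p) \<in> homogeneous_polynomials (n - 2)" for j
    using homogeneous_partial_deriv[OF homogeneous_partial_deriv[OF assms]] by (simp add: numeral_2_eq_2)
  then have "real_polynomial_function (laplacian p)"
    unfolding laplacian_def
    by (intro real_polynomial_function_sum) (auto simp: homogeneous_polynomials_def)
  moreover have "laplacian p (c *\<^sub>R x) = c ^ (n - 2) * laplacian p x" for c x
    using d by (simp add: laplacian_def homogeneous_polynomials_def sum_distrib_left)
  ultimately show ?thesis by (simp add: homogeneous_polynomials_def)
qed

lemma laplacian_homogeneous_1:
  assumes "p \<in> homogeneous_polynomials 1"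
  shows "laplacian p = (\<lambda>_. 0)"
  using homogeneous_partial_deriv[OF assms]
  by (auto simp: laplacian_def partial_deriv_homogeneous_0)

context dunkl_setting
begin

lemma gamma_nonneg: "dunkl_gamma P k \<ge> 0"
  by (simp add: dunkl_gamma_def sum_nonneg k_nonneg_P)

lemma weighted_polynomial_bounded_on_sphere:
  assumes "continuous_on UNIV q"
  obtains C where "\<And>x. norm x = 1 \<Longrightarrow> \<bar>q x * dunkl_weight P k x\<bar> \<le> C"
proof -
  have "compact ((\<lambda>x. \<bar>q x\<bar> * smooth_weight 1 x) ` sphere 0 1)"
    by (intro compact_continuous_image continuous_on_mult continuous_on_rabs compact_sphere
        continuous_on_subset[OF assms] continuous_on_subset[OF continuous_smooth_weight]) auto
  then obtain C where "\<forall>y\<in>(\<lambda>x. \<bar>q x\<bar> * smooth_weight 1 x) ` sphere 0 1. norm y \<le> C"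
    by (auto simp only: bounded_iff dest!: compact_imp_bounded)
  then have C: "\<bar>\<bar>q x\<bar> * smooth_weight 1 x\<bar> \<le> C" if "norm x = 1" for x
    using that by auto
  have "\<bar>q x * dunkl_weight P k x\<bar> \<le> C" if "norm x = 1" for x
  proof -
    have "\<bar>q x * dunkl_weight P k x\<bar> \<le> \<bar>q x\<bar> * smooth_weight 1 x"
      using dunkl_weight_nonneg[of x] by (simp add: abs_mult mult_left_mono dunkl_weight_le)
    also have "\<dots> \<le> C" using C[OF that] by linarith
    finally show ?thesis .
  qed
  then show ?thesis using that by blast
qed

lemma homogeneous_weighted_ball_integral:
  assumes q: "q \<in> homogeneous_polynomials n" and "n + 2 * dunkl_gamma P k + real CARD('n) > 0" "b > 0"
  shows "has_bochner_integral lborel (\<lambda>x. indicator (cball 0 1) x *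
      ((q x * dunkl_weight P k x) * (1 - (norm x)\<^sup>2) powr (b - 1)))
    (Beta ((n + 2 * dunkl_gamma P k + real CARD('n)) / 2) b / 2 *
      (\<integral>\<xi>. q \<xi> * dunkl_weight P k \<xi> \<partial>surface_measure))"
proof -
  have rq: "continuous_on UNIV q"
    using q by (intro continuous_on_real_polynomial_function) (simp add: homogeneous_polynomials_def)
  have [measurable]: "q \<in> borel_measurable borel" by (intro borel_measurable_continuous_onI rq)
  obtain C where C: "\<And>x. norm x = 1 \<Longrightarrow> \<bar>q x * dunkl_weight P k x\<bar> \<le> C"
    using weighted_polynomial_bounded_on_sphere[OF rq] by blast
  show ?thesis
  proof (rule homogeneous_ball_integral[OF _ _ C assms(2,3)])
    show "(\<lambda>x. q x * dunkl_weight P k x) \<in> borel_measurable borel" by measurable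
    show "q (c *\<^sub>R x) * dunkl_weight P k (c *\<^sub>R x) =
        c powr (n + 2 * dunkl_gamma P k) * (q x * dunkl_weight P k x)" if "c > 0" for c x
      using q that by (simp add: dunkl_weight_scale[OF finite_P that] homogeneous_polynomials_def
          powr_add powr_realpow)
  qed
qed

text \<open>Both ball integrals in Green's identity are beta multiples of sphere integrals: with
$2a = n + 2\gamma + d - 2$ they are $\frac12 B(a, 3)$ and $\frac12 B(a + 1, 2)$ times the sphere integrals.
Since $B(a + 1, 2) = \frac a2 B(a, 3)$, the eigenvalue is $2na$.  In degree $1$, where $n - 2$ is not a
degree, the Laplacian is zero.\<close>

lemma sphere_integral_laplacian:
  assumes d: "CARD('n) \<ge> 2" and V: "dunkl_intertwining P k V"
    and p: "p \<in> homogeneous_polynomials n" and n: "n \<ge> 1"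
  shows "(\<integral>\<xi>. V (laplacian p) \<xi> * dunkl_weight P k \<xi> \<partial>surface_measure) =
    n * (n + 2 * dunkl_gamma P k + real CARD('n) - 2) *
    (\<integral>\<xi>. V p \<xi> * dunkl_weight P k \<xi> \<partial>surface_measure)"
proof -
  define a where "a = (n + 2 * dunkl_gamma P k + real CARD('n) - 2) / 2"
  have a: "a > 0" using d n gamma_nonneg by (auto simp: a_def)
  define L where "L q = (\<integral>\<xi>. V q \<xi> * dunkl_weight P k \<xi> \<partial>surface_measure)" for q
  have Vp: "V p \<in> homogeneous_polynomials n" by (rule dunkl_intertwining_homogeneous[OF V p])
  have 1: "(\<integral>x. V p x * bump x * dunkl_weight P k x \<partial>lborel) = Beta (a + 1) 2 / 2 * L p"
  proof -
    have f: "(\<lambda>x. indicator (cball 0 1) x * ((V p x * dunkl_weight P k x) * (1 - (norm x)\<^sup>2) powr (2 - 1))) =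
        (\<lambda>x. V p x * bump x * dunkl_weight P k x)"
      by (auto simp: fun_eq_iff indicator_def bump_eq_0 bump_def power_le_one)
    have e: "(n + 2 * dunkl_gamma P k + real CARD('n)) / 2 = a + 1"
      by (simp add: a_def field_simps)
    have "n + 2 * dunkl_gamma P k + real CARD('n) > 0" using a by (simp add: a_def)
    from homogeneous_weighted_ball_integral[OF Vp this, of 2] show ?thesis
      unfolding e f by (simp add: has_bochner_integral_iff L_def)
  qed
  have 2: "(\<integral>x. V (laplacian p) x * (bump x)\<^sup>2 * dunkl_weight P k x \<partial>lborel) = Beta a 3 / 2 * L (laplacian p)"
  proof (cases "n = 1")
    case True
    then show ?thesis
      using laplacian_homogeneous_1[of p] p by (simp add: L_def dunkl_intertwining_zero[OF V])
  next
    case False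
    then have n2: "real (n - 2) = real n - 2" using n by auto
    have VL: "V (laplacian p) \<in> homogeneous_polynomials (n - 2)"
      by (rule dunkl_intertwining_homogeneous[OF V laplacian_homogeneous[OF p]])
    have f: "(\<lambda>x. indicator (cball 0 1) x * ((V (laplacian p) x * dunkl_weight P k x) * (1 - (norm x)\<^sup>2) powr (3 - 1))) =
        (\<lambda>x. V (laplacian p) x * (bump x)\<^sup>2 * dunkl_weight P k x)"
      by (auto simp: fun_eq_iff indicator_def bump_eq_0 bump_def power_le_one powr_numeral)
    have e: "(real (n - 2) + 2 * dunkl_gamma P k + real CARD('n)) / 2 = a"
      by (simp add: a_def n2)
    have "real (n - 2) + 2 * dunkl_gamma P k + real CARD('n) > 0" 
      using a unfolding e[symmetric] by simp
    from homogeneous_weighted_ball_integral[OF VL this, of 3] show ?thesis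
      unfolding e f by (simp add: has_bochner_integral_iff L_def)
  qed
  have "Beta a 3 / 2 * L (laplacian p) = 4 * n * (Beta (a + 1) 2 / 2 * L p)"
    using dunkl_intertwining_green[OF V p] by (simp add: 1 2)
  moreover have "Beta (a + 1) 2 = a / 2 * Beta a 3"
  proof -
    have "(a + 2) * Beta a 3 = 2 * Beta a 2" using Beta_plus1_right[of "2::real" a] by (simp add: pos_not_in_nonpos_Ints)
    moreover have "(a + 2) * Beta (a + 1) 2 = a * Beta a 2" using Beta_plus1_left[of a 2] a by (simp add: pos_not_in_nonpos_Ints)
    ultimately have "(a + 2) * Beta (a + 1) 2 = (a + 2) * (a / 2 * Beta a 3)" by simp
    then show ?thesis using a by simp
  qed
  moreover have "Beta a 3 > 0"
    using a by (simp add: Beta_def)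
  ultimately have "L (laplacian p) = n * (2 * a) * L p" by simp
  also have "2 * a = n + 2 * dunkl_gamma P k + real CARD('n) - 2" by (simp add: a_def)
  finally show ?thesis by (simp only: L_def)
qed

end

lemma dunkl_setting_empty: "dunkl_setting {} {} \<beta> k"
  by unfold_locales
     (auto simp: normalized_root_system_def regular_vector_def positive_roots_def multiplicity_invariant_def)

lemma dunkl_intertwining_empty: "dunkl_intertwining {} k (\<lambda>p. p)"
  by (auto simp: dunkl_intertwining_def dunkl_operator_def)

lemma sphere_integral_laplacian_unweighted:
  fixes p :: "real^'n \<Rightarrow> real"
  assumes "CARD('n) \<ge> 2" "p \<in> homogeneous_polynomials n" "n \<ge> 1"
  shows "(\<integral>\<xi>. laplacian p \<xi> \<partial>surface_measure) =
    n * (n + real CARD('n) - 2) * (\<integral>\<xi>. p \<xi> \<partial>surface_measure)"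
  using dunkl_setting.sphere_integral_laplacian[OF dunkl_setting_empty assms(1) dunkl_intertwining_empty assms(2,3)]
  by (simp add: dunkl_weight_def dunkl_gamma_def)

lemma surface_measure_total:
  "(\<integral>\<xi>. 1 \<partial>(surface_measure :: (real^'n) measure)) =
    2 * pi powr (real CARD('n) / 2) / Gamma (real CARD('n) / 2)"
proof -
  let ?d = "real CARD('n)"
  have "(\<integral>\<xi>. 1 \<partial>(surface_measure :: (real^'n) measure)) = ?d * unit_ball_vol ?d"
    using integral_surface_measure[of "\<lambda>_::real^'n. 1"] by (simp add: content_cball)
  also have "\<dots> = 2 * pi powr (?d / 2) / Gamma (?d / 2)"
  proof -
    have G: "Gamma (?d / 2 + 1) = ?d / 2 * Gamma (?d / 2)"
      by (intro Gamma_plus1 pos_not_in_nonpos_Ints) simp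
    show ?thesis unfolding unit_ball_vol_def G by simp
  qed
  finally show ?thesis .
qed

context dunkl_setting
begin

text \<open>Induction on the degree in steps of two.  In degree $0$ the constant $K$ is exactly what is needed, because
the sphere has area $2\pi^{d/2}/\Gamma(d/2)$.  In degree $1$ both integrals vanish by the eigenvalue
identities.  In the step, the ratio of the eigenvalues is that of $x$ to $x + \gamma$ for $x = \frac{n+d}2 - 1$,
and $(x + \gamma) B(x + 1, \gamma) = x B(x, \gamma)$.\<close>

lemma intertwining_sphere_integral:
  fixes p :: "real^'n \<Rightarrow> real"
  assumes d: "CARD('n) \<ge> 2" and V: "dunkl_intertwining P k V" and \<gamma>: "dunkl_gamma P k > 0"
  defines "\<gamma> \<equiv> dunkl_gamma P k" and "d \<equiv> real CARD('n)"
  defines "K \<equiv> Gamma (\<gamma> + d / 2) * dunkl_sphere_mass P k / (pi powr (d / 2) * Gamma \<gamma>)"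
  shows "p \<in> homogeneous_polynomials n \<Longrightarrow>
    (\<integral>\<xi>. V p \<xi> * dunkl_weight P k \<xi> \<partial>surface_measure) =
    K * (Beta ((n + d) / 2) \<gamma> / 2 * (\<integral>\<xi>. p \<xi> \<partial>surface_measure))"
proof (induction n arbitrary: p rule: less_induct)
  case (less n)
  note p = less.prems
  have \<gamma>0: "\<gamma> > 0" using \<gamma> by (simp add: \<gamma>_def)
  have d2: "d \<ge> 2" using d by (simp add: d_def)
  define L where "L q = (\<integral>\<xi>. V q \<xi> * dunkl_weight P k \<xi> \<partial>surface_measure)" for q
  define S where "S q = (\<integral>\<xi>. q \<xi> \<partial>surface_measure)" for q :: "real^'n \<Rightarrow> real"
  have L: "L (laplacian p) = n * (n + 2 * \<gamma> + d - 2) * L p"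
    and S: "S (laplacian p) = n * (n + d - 2) * S p" if "n \<ge> 1"
    using sphere_integral_laplacian[OF d V p that] sphere_integral_laplacian_unweighted[OF d p that]
    by (simp_all add: L_def S_def \<gamma>_def d_def)
  consider "n = 0" | "n = 1" | "n \<ge> 2" by linarith
  then have "L p = K * (Beta ((n + d) / 2) \<gamma> / 2 * S p)"
  proof cases
    case 1
    define c where "c = p 0"
    have pc: "p = (\<lambda>x. c * 1)" using homogeneous_0_const[of p] p 1 by (simp add: c_def)
    have "V p = (\<lambda>x. c * V (\<lambda>x. 1) x)"
      unfolding pc by (rule dunkl_intertwining_cmult[OF V]) (rule real_polynomial_function.intros(2))
    moreover have "V (\<lambda>x. 1) = (\<lambda>x. 1)" using V by (simp add: dunkl_intertwining_def)
    ultimately have Lp: "L p = c * dunkl_sphere_mass P k"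
      by (simp add: L_def dunkl_sphere_mass_def)
    have Sp: "S p = c * (2 * pi powr (d / 2) / Gamma (d / 2))"
      using surface_measure_total[where ?'n = 'n] by (simp add: S_def pc d_def)
    have G: "Gamma \<gamma> > 0" "Gamma (\<gamma> + d / 2) > 0" "Gamma (d / 2) > 0"
      using \<gamma>0 d2 by (auto intro!: Gamma_real_pos)
    have KB: "K * Beta (d / 2) \<gamma> = dunkl_sphere_mass P k * Gamma (d / 2) / pi powr (d / 2)"
      using G by (simp add: K_def Beta_def add.commute[of "d / 2"])
    have "K * (Beta (d / 2) \<gamma> / 2 * S p) = (K * Beta (d / 2) \<gamma>) * S p / 2" by simp
    also have "\<dots> = L p" unfolding KB Sp Lp using G by simp
    finally show ?thesis using 1 by simp
  next
    case 2
    have "laplacian p = (\<lambda>_. 0)" using laplacian_homogeneous_1 p 2 by blast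
    then have "L (laplacian p) = 0" "S (laplacian p) = 0"
      by (simp_all add: L_def S_def dunkl_intertwining_zero[OF V])
    then have "L p = 0" "S p = 0" using L S 2 \<gamma>0 d2 by auto
    then show ?thesis by simp
  next
    case 3
    define x where "x = (n + d) / 2 - 1"
    have x: "x > 0" using 3 d2 by (simp add: x_def)
    define y where "y = x + \<gamma>"
    have y: "y > 0" using x \<gamma>0 by (simp add: y_def)
    have r: "real (n - 2) = real n - 2" using 3 by simp
    have "L (laplacian p) = K * (Beta ((real (n - 2) + d) / 2) \<gamma> / 2 * S (laplacian p))"
      unfolding L_def S_def using 3 by (intro less.IH laplacian_homogeneous p) auto
    also have "(real (n - 2) + d) / 2 = x" by (simp add: x_def r field_simps)
    finally have "n * (2 * y) * L p = K * (Beta x \<gamma> / 2 * (n * (2 * x) * S p))"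
      using L S 3 by (simp add: x_def y_def field_simps)
    also have "\<dots> = K * n * S p * (x * Beta x \<gamma>)" by simp
    also have "x * Beta x \<gamma> = y * Beta (x + 1) \<gamma>"
      unfolding y_def using x by (intro Beta_plus1_left[symmetric] pos_not_in_nonpos_Ints)
    finally have "n * (2 * y) * L p = n * (2 * y) * (K * (Beta (x + 1) \<gamma> / 2 * S p))"
      by (simp add: mult_ac)
    then have "L p = K * (Beta (x + 1) \<gamma> / 2 * S p)"
      using y 3 by simp
    then show ?thesis by (simp add: x_def)
  qed
  then show ?case by (simp add: L_def S_def)
qed

end

section \<open>From polynomials to continuous functions\<close>

lemma represents_intertwining_integrable:
  fixes h :: "real^'n \<Rightarrow> real"
  assumes \<mu>: "represents_intertwining V \<mu>" and h: "continuous_on UNIV h"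
  shows "integrable (\<mu> x) h"
proof -
  interpret prob_space "\<mu> x" using \<mu> by (simp add: represents_intertwining_def)
  have s [measurable_cong, simp]: "sets (\<mu> x) = sets borel" and null: "emeasure (\<mu> x) (- cball 0 (norm x)) = 0"
    using \<mu> by (simp_all add: represents_intertwining_def)
  have "bounded (h ` cball 0 (norm x))"
    by (intro compact_imp_bounded compact_continuous_image continuous_on_subset[OF h] compact_cball) auto
  then obtain C where C: "\<forall>y\<in>h ` cball 0 (norm x). norm y \<le> C"
    by (auto simp only: bounded_iff)
  have hm: "h \<in> borel_measurable borel" by (rule borel_measurable_continuous_onI[OF h])
  have "- cball 0 (norm x) \<in> null_sets (\<mu> x)" using null by (intro null_setsI) auto
  from AE_not_in[OF this] have "AE y in \<mu> x. norm (h y) \<le> C"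
    by eventually_elim (use C in auto)
  then show ?thesis using hm by (intro integrable_const_bound[of h C]) (auto cong: measurable_cong_sets)
qed

text \<open>The representing measure is a probability measure on the closed ball of radius $|x|$, so the error of an approximation on
that ball is not increased.\<close>

lemma represents_intertwining_close:
  fixes h p :: "real^'n \<Rightarrow> real"
  assumes \<mu>: "represents_intertwining V \<mu>" and h: "continuous_on UNIV h"
    and p: "real_polynomial_function p"
    and close: "\<And>y. norm y \<le> norm x \<Longrightarrow> \<bar>h y - p y\<bar> \<le> e"
  shows "\<bar>intertwining_extension \<mu> h x - V p x\<bar> \<le> e"
proof -
  interpret prob_space "\<mu> x" using \<mu> by (simp add: represents_intertwining_def)
  have s: "sets (\<mu> x) = sets borel" and null: "emeasure (\<mu> x) (- cball 0 (norm x)) = 0"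
    and Vp: "V p x = (\<integral>y. p y \<partial>\<mu> x)"
    using \<mu> p by (simp_all add: represents_intertwining_def)
  have ih: "integrable (\<mu> x) h" and ip: "integrable (\<mu> x) p"
    using \<mu> h p by (auto intro: represents_intertwining_integrable continuous_on_real_polynomial_function)
  have "- cball 0 (norm x) \<in> null_sets (\<mu> x)" using null by (intro null_setsI) (auto simp: s)
  from AE_not_in[OF this] have ae: "AE y in \<mu> x. \<bar>h y - p y\<bar> \<le> e"
    by eventually_elim (use close in auto)
  have "\<bar>intertwining_extension \<mu> h x - V p x\<bar> = \<bar>\<integral>y. h y - p y \<partial>\<mu> x\<bar>"
    using ih ip by (simp add: intertwining_extension_def Vp)
  also have "\<dots> \<le> (\<integral>y. \<bar>h y - p y\<bar> \<partial>\<mu> x)" by (rule integral_abs_bound)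
  also have "\<dots> \<le> (\<integral>y. e \<partial>\<mu> x)"
    using ih ip ae by (intro integral_mono_AE) auto
  also have "\<dots> = e" by (simp add: prob_space)
  finally show ?thesis .
qed

text \<open>For a homogeneous polynomial both sides scale with $t^n$, which leaves \<open>intertwining_sphere_integral\<close> and
polar coordinates.  The integrability statements are carried along so that the formula is additive.\<close>

lemma (in dunkl_setting) intertwining_ball_formula_polynomial:
  fixes p :: "real^'n \<Rightarrow> real"
  assumes d: "CARD('n) \<ge> 2" and V: "dunkl_intertwining P k V" and \<gamma>: "dunkl_gamma P k > 0"
    and p: "real_polynomial_function p"
  defines "\<gamma> \<equiv> dunkl_gamma P k" and "d \<equiv> real CARD('n)"
  defines "K \<equiv> Gamma (\<gamma> + d / 2) * dunkl_sphere_mass P k / (pi powr (d / 2) * Gamma \<gamma>)"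
  shows "real_polynomial_function (V p) \<and>
    integrable lborel (\<lambda>x. indicator (cball 0 1) x * (p (t *\<^sub>R x) * (1 - (norm x)\<^sup>2) powr (\<gamma> - 1))) \<and>
    (\<integral>\<xi>. V p (t *\<^sub>R \<xi>) * dunkl_weight P k \<xi> \<partial>surface_measure) =
    K * (\<integral>x. indicator (cball 0 1) x * (p (t *\<^sub>R x) * (1 - (norm x)\<^sup>2) powr (\<gamma> - 1)) \<partial>lborel)"
  using polynomial_in_homogeneous_sums[OF p]
proof induction
  case (base p n)
  have Vp: "V p \<in> homogeneous_polynomials n" by (rule dunkl_intertwining_homogeneous[OF V base])
  have h: "p (c *\<^sub>R x) = c ^ n * p x" "V p (c *\<^sub>R x) = c ^ n * V p x" for c x
    using base Vp by (auto simp: homogeneous_polynomials_def)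
  have pos: "real n + 2 * dunkl_gamma {} k + real CARD('n) > 0" "\<gamma> > 0"
    using \<gamma> by (simp_all add: \<gamma>_def dunkl_gamma_def add_nonneg_pos)
  have B: "has_bochner_integral lborel (\<lambda>x. indicator (cball 0 1) x * (p x * (1 - (norm x)\<^sup>2) powr (\<gamma> - 1)))
      (Beta ((n + d) / 2) \<gamma> / 2 * (\<integral>\<xi>. p \<xi> \<partial>surface_measure))"
    using dunkl_setting.homogeneous_weighted_ball_integral[OF dunkl_setting_empty base pos]
    by (simp add: dunkl_weight_def dunkl_gamma_def d_def)
  have e: "(\<lambda>x. indicator (cball 0 1) x * (p (t *\<^sub>R x) * (1 - (norm x)\<^sup>2) powr (\<gamma> - 1))) =
      (\<lambda>x. t ^ n * (indicator (cball 0 1) x * (p x * (1 - (norm x)\<^sup>2) powr (\<gamma> - 1))))"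
    by (simp add: h mult_ac)
  define I where "I = Beta ((n + d) / 2) \<gamma> / 2 * (\<integral>\<xi>. p \<xi> \<partial>surface_measure)"
  have "has_bochner_integral lborel (\<lambda>x. indicator (cball 0 1) x * (p (t *\<^sub>R x) * (1 - (norm x)\<^sup>2) powr (\<gamma> - 1)))
      (t ^ n * I)"
    unfolding e I_def by (rule has_bochner_integral_mult_right) (rule B)
  moreover have "(\<integral>\<xi>. V p (t *\<^sub>R \<xi>) * dunkl_weight P k \<xi> \<partial>surface_measure) = K * (t ^ n * I)"
  proof -
    have "(\<integral>\<xi>. V p (t *\<^sub>R \<xi>) * dunkl_weight P k \<xi> \<partial>surface_measure) =
        t ^ n * (\<integral>\<xi>. V p \<xi> * dunkl_weight P k \<xi> \<partial>surface_measure)"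
      by (simp add: h mult.assoc)
    also have "\<dots> = t ^ n * (K * I)"
      using intertwining_sphere_integral[OF d V \<gamma> base] by (simp add: K_def \<gamma>_def d_def I_def)
    finally show ?thesis by (simp only: mult.left_commute)
  qed
  moreover have "real_polynomial_function (V p)" using Vp by (simp add: homogeneous_polynomials_def)
  ultimately show ?case by (simp only: has_bochner_integral_iff simp_thms)
next
  case (add p q)
  have rp: "real_polynomial_function p" "real_polynomial_function q"
    using add.hyps by (auto intro: homogeneous_sums_polynomial)
  have Vpq: "V (\<lambda>x. p x + q x) = (\<lambda>x. V p x + V q x)"
    by (rule dunkl_intertwining_add[OF V rp])
  have i: "integrable surface_measure (\<lambda>\<xi>. V p (t *\<^sub>R \<xi>) * dunkl_weight P k \<xi>)"
    if "real_polynomial_function (V p)" for p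
  proof -
    have c: "continuous_on UNIV (\<lambda>\<xi>. V p (t *\<^sub>R \<xi>))"
      by (intro continuous_on_compose2[OF continuous_on_real_polynomial_function[OF that]]
          continuous_on_scaleR continuous_on_const continuous_on_id) auto
    obtain C where C: "\<And>x. norm x = 1 \<Longrightarrow> \<bar>V p (t *\<^sub>R x) * dunkl_weight P k x\<bar> \<le> C"
      using weighted_polynomial_bounded_on_sphere[OF c] by blast
    have [measurable]: "(\<lambda>\<xi>. V p (t *\<^sub>R \<xi>)) \<in> borel_measurable borel"
      by (rule borel_measurable_continuous_onI[OF c])
    show ?thesis by (rule integrable_surface_measure[OF measurable_restrict_space1 C]) measurable
  qed
  show ?case
    using add.IH by (auto simp: Vpq distrib_left distrib_right i)
qed

text \<open>Substitution $y = t x$.  The change from the open to the closed ball is harmless since $0$ to any power is $0$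
in \<open>powr\<close>.\<close>

lemma ball_integral_rescale:
  fixes h :: "real^'n \<Rightarrow> real"
  assumes [measurable]: "h \<in> borel_measurable borel" and t: "t > 0"
  shows "t powr (2 - 2 * \<gamma> - real CARD('n)) *
      (LINT y:ball 0 t|lborel. h y * (t\<^sup>2 - (norm y)\<^sup>2) powr (\<gamma> - 1)) =
    (\<integral>x. indicator (cball 0 1) x * (h (t *\<^sub>R x) * (1 - (norm x)\<^sup>2) powr (\<gamma> - 1)) \<partial>lborel)"
proof -
  define w where "w x = indicator (cball 0 1) x * (1 - (norm x)\<^sup>2) powr (\<gamma> - 1)" for x :: "real^'n"
  define B where "B = (\<integral>x. h (t *\<^sub>R x) * w x \<partial>lborel)"
  have "(LINT y:ball 0 t|lborel. h y * (t\<^sup>2 - (norm y)\<^sup>2) powr (\<gamma> - 1)) =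
      (\<integral>y. indicator (ball 0 t) y * (h y * (t\<^sup>2 - (norm y)\<^sup>2) powr (\<gamma> - 1)) \<partial>lborel)"
    by (simp add: set_lebesgue_integral_def)
  also have "\<dots> = t ^ CARD('n) * (\<integral>x. indicator (ball 0 t) (t *\<^sub>R x) *
      (h (t *\<^sub>R x) * (t\<^sup>2 - (norm (t *\<^sub>R x))\<^sup>2) powr (\<gamma> - 1)) \<partial>lborel)"
  proof (rule integral_lborel_scale[OF _ t])
    have [measurable]: "ball (0::real^'n) t \<in> sets borel" by (rule borel_open) simp
    show "(\<lambda>y. indicator (ball 0 t) y * (h y * (t\<^sup>2 - (norm y)\<^sup>2) powr (\<gamma> - 1))) \<in> borel_measurable borel"
      by measurable
  qed
  also have "(\<lambda>x. indicator (ball 0 t) (t *\<^sub>R x) * (h (t *\<^sub>R x) * (t\<^sup>2 - (norm (t *\<^sub>R x))\<^sup>2) powr (\<gamma> - 1))) =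
      (\<lambda>x. (t\<^sup>2) powr (\<gamma> - 1) * (h (t *\<^sub>R x) * w x))"
  proof
    fix x :: "real^'n"
    have "t\<^sup>2 - (norm (t *\<^sub>R x))\<^sup>2 = t\<^sup>2 * (1 - (norm x)\<^sup>2)"
      using t by (simp add: power_mult_distrib algebra_simps)
    then have e: "(t\<^sup>2 - (norm (t *\<^sub>R x))\<^sup>2) powr (\<gamma> - 1) = (t\<^sup>2) powr (\<gamma> - 1) * (1 - (norm x)\<^sup>2) powr (\<gamma> - 1)"
      if "norm x \<le> 1"
      using that by (simp add: powr_mult power_le_one)
    have i: "t *\<^sub>R x \<in> ball 0 t \<longleftrightarrow> norm x < 1" using t by simp
    consider "norm x < 1" | "norm x = 1" | "norm x > 1" by linarith
    then show "indicator (ball 0 t) (t *\<^sub>R x) * (h (t *\<^sub>R x) * (t\<^sup>2 - (norm (t *\<^sub>R x))\<^sup>2) powr (\<gamma> - 1)) =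
        (t\<^sup>2) powr (\<gamma> - 1) * (h (t *\<^sub>R x) * w x)"
      by cases (use e i in \<open>simp_all add: w_def indicator_def del: mem_ball norm_scaleR\<close>)
  qed
  also have "(\<integral>x. (t\<^sup>2) powr (\<gamma> - 1) * (h (t *\<^sub>R x) * w x) \<partial>lborel) = (t\<^sup>2) powr (\<gamma> - 1) * B"
    by (simp add: B_def)
  also have "t ^ CARD('n) = t powr real CARD('n)" using t by (simp add: powr_realpow)
  also have "(t\<^sup>2) powr (\<gamma> - 1) = t powr (2 * (\<gamma> - 1))"
    using t powr_powr[of t 2 "\<gamma> - 1"] by (simp add: powr_numeral)
  finally have "t powr (2 - 2 * \<gamma> - real CARD('n)) *
    (LINT y:ball 0 t|lborel. h y * (t\<^sup>2 - (norm y)\<^sup>2) powr (\<gamma> - 1)) =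
    (t powr (2 - 2 * \<gamma> - real CARD('n)) * t powr real CARD('n) * t powr (2 * (\<gamma> - 1))) * B"
    by (simp only: mult.assoc)
  also have "t powr (2 - 2 * \<gamma> - real CARD('n)) * t powr real CARD('n) * t powr (2 * (\<gamma> - 1)) =
      t powr ((2 - 2 * \<gamma> - real CARD('n)) + real CARD('n) + 2 * (\<gamma> - 1))"
    by (simp only: powr_add)
  also have "\<dots> = 1" using t by simp
  finally show ?thesis by (simp add: B_def w_def mult_ac)
qed

theorem theorem4p2:
  fixes R P :: "(real^'n) set"
    and \<beta> :: "real^'n"
    and k :: "real^'n \<Rightarrow> real"
    and V :: "(real^'n \<Rightarrow> real) \<Rightarrow> (real^'n \<Rightarrow> real)"
    and \<mu> :: "real^'n \<Rightarrow> (real^'n) measure"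
    and h :: "real^'n \<Rightarrow> real"
    and t \<gamma> :: real
  assumes "CARD('n) \<ge> 2"
    and "normalized_root_system R" and "R \<noteq> {}"
    and "regular_vector R \<beta>" and "P = positive_roots R \<beta>"
    and "multiplicity_invariant R k" and "\<forall>\<alpha>\<in>R. k \<alpha> > 0"
    and "\<gamma> = dunkl_gamma P k"
    and "dunkl_intertwining P k V"
    and "represents_intertwining V \<mu>"
    and "continuous_on UNIV h"
    and "t > 0"
  shows "(\<integral>\<xi>. intertwining_extension \<mu> h (t *\<^sub>R \<xi>) * dunkl_weight P k \<xi> \<partial>surface_measure) =
    Gamma (\<gamma> + real CARD('n) / 2) * dunkl_sphere_mass P k / (pi powr (real CARD('n) / 2) * Gamma \<gamma>)
      * t powr (2 - 2 * \<gamma> - real CARD('n))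
      * (LINT y:ball 0 t|lborel. h y * (t\<^sup>2 - (norm y)\<^sup>2) powr (\<gamma> - 1))"
proof -
  interpret dunkl_setting R P \<beta> k
    by unfold_locales (use assms in \<open>auto simp: less_imp_le\<close>)
  note V = assms(9) and \<mu> = assms(10) and h = assms(11) and t = assms(12)
  have "P \<noteq> {}" using R_split assms(3) by auto
  then have \<gamma>0: "dunkl_gamma P k > 0"
    unfolding dunkl_gamma_def using assms(7) P_subset finite_P by (intro sum_pos) auto
  define K where "K = Gamma (\<gamma> + real CARD('n) / 2) * dunkl_sphere_mass P k / (pi powr (real CARD('n) / 2) * Gamma \<gamma>)"
  define w where "w x = indicator (cball 0 1) x * (1 - (norm x)\<^sup>2) powr (\<gamma> - 1)" for x :: "real^'n"
  define A where "A = (\<integral>\<xi>. intertwining_extension \<mu> h (t *\<^sub>R \<xi>) * dunkl_weight P k \<xi> \<partial>surface_measure)"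
  define B where "B f = (\<integral>x. f (t *\<^sub>R x) * w x \<partial>lborel)" for f :: "real^'n \<Rightarrow> real"
  have w0: "w x \<ge> 0" for x by (simp add: w_def)
  have pol: "real_polynomial_function (V p)" "integrable lborel (\<lambda>x. p (t *\<^sub>R x) * w x)"
    "(\<integral>\<xi>. V p (t *\<^sub>R \<xi>) * dunkl_weight P k \<xi> \<partial>surface_measure) = K * B p"
    if "real_polynomial_function p" for p
    using intertwining_ball_formula_polynomial[OF assms(1) V \<gamma>0 that, of t]
    by (simp_all add: K_def B_def w_def assms(8) mult_ac)
  have intw: "integrable lborel w"
    using pol(2)[OF real_polynomial_function.intros(2)[of 1]] by simp
  have [measurable]: "h \<in> borel_measurable borel" by (rule borel_measurable_continuous_onI[OF h])
  \<comment> \<open>Weierstrass approximation on the closed ball of radius \<open>t\<close>\<close>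
  have approx: "\<exists>p. real_polynomial_function p \<and> (\<forall>x\<in>cball 0 t. \<bar>h x - p x\<bar> < e)" if "e > 0" for e
    using Stone_Weierstrass_real_polynomial_function[of "cball 0 t" h e] that
      continuous_on_subset[OF h] by (metis compact_cball subset_UNIV)
  let ?E = "\<lambda>\<xi>. intertwining_extension \<mu> h (t *\<^sub>R \<xi>)"
  have closeE: "\<bar>?E \<xi> - V p (t *\<^sub>R \<xi>)\<bar> \<le> e"
    if "real_polynomial_function p" "\<forall>x\<in>cball 0 t. \<bar>h x - p x\<bar> < e" "norm \<xi> = 1" for p e \<xi>
    by (rule represents_intertwining_close[OF \<mu> h that(1)]) (use that t in \<open>auto intro: less_imp_le\<close>)
  let ?S = "restrict_space borel (sphere 0 1) :: (real^'n) measure"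
  have contV: "continuous_on UNIV (\<lambda>\<xi>. V p (t *\<^sub>R \<xi>))" if "real_polynomial_function p" for p
    by (intro continuous_on_compose2[OF continuous_on_real_polynomial_function[OF pol(1)[OF that]]]
        continuous_on_scaleR continuous_on_const continuous_on_id) auto
  have measV: "(\<lambda>\<xi>. V p (t *\<^sub>R \<xi>)) \<in> borel_measurable ?S" if "real_polynomial_function p" for p
    by (rule measurable_restrict_space1[OF borel_measurable_continuous_onI[OF contV[OF that]]])
  have measw: "dunkl_weight P k \<in> borel_measurable ?S"
    by (rule measurable_restrict_space1) measurable
  \<comment> \<open>on the sphere \<open>?E\<close> is a limit of polynomials, hence measurable\<close>
  have measE: "?E \<in> borel_measurable ?S"
  proof -
    have "\<forall>m. \<exists>p. real_polynomial_function p \<and> (\<forall>x\<in>cball 0 t. \<bar>h x - p x\<bar> < 1 / real (Suc m))"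
      by (intro allI approx) simp
    from choice[OF this] obtain p where p: "\<And>m. real_polynomial_function (p m)"
      "\<And>m. \<forall>x\<in>cball 0 t. \<bar>h x - p m x\<bar> < 1 / real (Suc m)" by blast
    show ?thesis
    proof (rule borel_measurable_LIMSEQ_real)
      show "(\<lambda>\<xi>. V (p m) (t *\<^sub>R \<xi>)) \<in> borel_measurable ?S" for m by (rule measV[OF p(1)])
      fix \<xi> assume "\<xi> \<in> space ?S"
      then have "norm \<xi> = 1" by (simp add: space_restrict_space)
      then have b: "norm (V (p m) (t *\<^sub>R \<xi>) - ?E \<xi>) \<le> 1 / real (Suc m)" for m
        unfolding real_norm_def by (subst abs_minus_commute) (rule closeE[OF p(1) p(2)])
      have "(\<lambda>m. 1 / real (Suc m)) \<longlonglongrightarrow> 0" using LIMSEQ_Suc[OF lim_1_over_n] by simp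
      from Lim_null_comparison[OF always_eventually[OF allI[OF b]] this]
      have "(\<lambda>m. V (p m) (t *\<^sub>R \<xi>) - ?E \<xi>) \<longlonglongrightarrow> 0" .
      then show "(\<lambda>m. V (p m) (t *\<^sub>R \<xi>)) \<longlonglongrightarrow> ?E \<xi>" by (rule LIM_zero_cancel)
    qed
  qed
  have intV: "integrable surface_measure (\<lambda>\<xi>. V p (t *\<^sub>R \<xi>) * dunkl_weight P k \<xi>)"
    if rp: "real_polynomial_function p" for p
  proof -
    obtain C where C: "\<And>x. norm x = 1 \<Longrightarrow> \<bar>V p (t *\<^sub>R x) * dunkl_weight P k x\<bar> \<le> C"
      using weighted_polynomial_bounded_on_sphere[OF contV[OF rp]] by blast
    show ?thesis
      by (rule integrable_surface_measure[OF borel_measurable_times[OF measV[OF rp] measw] C])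
  qed
  have intww: "integrable surface_measure (dunkl_weight P k)"
  proof -
    obtain C where C: "\<And>x. norm x = 1 \<Longrightarrow> \<bar>1 * dunkl_weight P k x\<bar> \<le> C"
      using weighted_polynomial_bounded_on_sphere[OF continuous_on_const[of UNIV 1]] by blast
    then show ?thesis by (intro integrable_surface_measure[OF measw]) auto
  qed
  \<comment> \<open>the identity holds for the approximating polynomial, so each side contributes one error term\<close>
  have bound: "\<bar>A - K * B h\<bar> \<le> e * (dunkl_sphere_mass P k + \<bar>K\<bar> * (\<integral>x. w x \<partial>lborel))" if e: "e > 0" for e
  proof -
    obtain p where p: "real_polynomial_function p" and ph: "\<forall>x\<in>cball 0 t. \<bar>h x - p x\<bar> < e"
      using approx[OF e] by blast
    have d1: "\<bar>?E \<xi> * dunkl_weight P k \<xi> - V p (t *\<^sub>R \<xi>) * dunkl_weight P k \<xi>\<bar> \<le> e * dunkl_weight P k \<xi>"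
      if "norm \<xi> = 1" for \<xi>
      using mult_right_mono[OF closeE[OF p ph that] dunkl_weight_nonneg[of \<xi>]] dunkl_weight_nonneg[of \<xi>]
      by (simp add: abs_mult flip: left_diff_distrib)
    have iD: "integrable surface_measure (\<lambda>\<xi>. ?E \<xi> * dunkl_weight P k \<xi> - V p (t *\<^sub>R \<xi>) * dunkl_weight P k \<xi>)"
    proof (rule Bochner_Integration.integrable_bound[OF integrable_mult_right[OF intww, of e]])
      show "(\<lambda>\<xi>. ?E \<xi> * dunkl_weight P k \<xi> - V p (t *\<^sub>R \<xi>) * dunkl_weight P k \<xi>) \<in> borel_measurable surface_measure"
        using measE measw measV[OF p] by (simp cong: measurable_cong_sets)
      show "AE \<xi> in surface_measure. norm (?E \<xi> * dunkl_weight P k \<xi> - V p (t *\<^sub>R \<xi>) * dunkl_weight P k \<xi>)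
          \<le> norm (e * dunkl_weight P k \<xi>)"
        using d1 e dunkl_weight_nonneg by (intro AE_I2) simp
    qed
    have iE: "integrable surface_measure (\<lambda>\<xi>. ?E \<xi> * dunkl_weight P k \<xi>)"
      using Bochner_Integration.integrable_add[OF iD intV[OF p]] by simp
    have "\<bar>A - K * B p\<bar> = \<bar>\<integral>\<xi>. ?E \<xi> * dunkl_weight P k \<xi> - V p (t *\<^sub>R \<xi>) * dunkl_weight P k \<xi> \<partial>surface_measure\<bar>"
      using iE intV[OF p] by (simp add: A_def pol(3)[OF p, symmetric])
    also have "\<dots> \<le> (\<integral>\<xi>. \<bar>?E \<xi> * dunkl_weight P k \<xi> - V p (t *\<^sub>R \<xi>) * dunkl_weight P k \<xi>\<bar> \<partial>surface_measure)"
      by (rule integral_abs_bound)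
    also have "\<dots> \<le> (\<integral>\<xi>. e * dunkl_weight P k \<xi> \<partial>surface_measure)"
      using iD intww d1 by (intro integral_mono) auto
    also have "\<dots> = e * dunkl_sphere_mass P k" by (simp add: dunkl_sphere_mass_def)
    finally have 1: "\<bar>A - K * B p\<bar> \<le> e * dunkl_sphere_mass P k" .
    have d2: "\<bar>h (t *\<^sub>R x) * w x - p (t *\<^sub>R x) * w x\<bar> \<le> e * w x" for x
    proof (cases "norm x \<le> 1")
      case True
      then have "t *\<^sub>R x \<in> cball 0 t" using t by simp
      then have "\<bar>h (t *\<^sub>R x) - p (t *\<^sub>R x)\<bar> \<le> e" using ph by (auto intro: less_imp_le)
      from mult_right_mono[OF this w0[of x]] show ?thesis
        using w0[of x] by (simp add: abs_mult flip: left_diff_distrib)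
    qed (simp add: w_def)
    have [measurable]: "w \<in> borel_measurable borel" using intw by simp
    have [measurable]: "p \<in> borel_measurable borel"
      by (intro borel_measurable_continuous_onI continuous_on_real_polynomial_function p)
    have iD2: "integrable lborel (\<lambda>x. h (t *\<^sub>R x) * w x - p (t *\<^sub>R x) * w x)"
    proof (rule Bochner_Integration.integrable_bound[OF integrable_mult_right[OF intw, of e]])
      show "AE x in lborel. norm (h (t *\<^sub>R x) * w x - p (t *\<^sub>R x) * w x) \<le> norm (e * w x)"
        using d2 e w0 by (intro AE_I2) simp
    qed measurable
    have ih: "integrable lborel (\<lambda>x. h (t *\<^sub>R x) * w x)"
      using Bochner_Integration.integrable_add[OF iD2 pol(2)[OF p]] by simp
    have "\<bar>B h - B p\<bar> = \<bar>\<integral>x. h (t *\<^sub>R x) * w x - p (t *\<^sub>R x) * w x \<partial>lborel\<bar>"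
      using ih pol(2)[OF p] by (simp add: B_def)
    also have "\<dots> \<le> (\<integral>x. \<bar>h (t *\<^sub>R x) * w x - p (t *\<^sub>R x) * w x\<bar> \<partial>lborel)"
      by (rule integral_abs_bound)
    also have "\<dots> \<le> (\<integral>x. e * w x \<partial>lborel)"
      using iD2 intw d2 by (intro integral_mono) auto
    also have "\<dots> = e * (\<integral>x. w x \<partial>lborel)" by simp
    finally have "\<bar>K\<bar> * \<bar>B h - B p\<bar> \<le> \<bar>K\<bar> * (e * (\<integral>x. w x \<partial>lborel))" by (rule mult_left_mono) simp
    then have 2: "\<bar>K * B h - K * B p\<bar> \<le> e * (\<bar>K\<bar> * (\<integral>x. w x \<partial>lborel))"
      by (simp add: abs_mult mult_ac flip: right_diff_distrib)
    have "\<bar>A - K * B h\<bar> \<le> \<bar>A - K * B p\<bar> + \<bar>K * B h - K * B p\<bar>" by linarith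
    with 1 2 show ?thesis by (simp add: distrib_left)
  qed
  have "A = K * B h"
  proof -
    \<comment> \<open>dividing by \<open>\<bar>M\<bar> + 1\<close> rather than \<open>M\<close> spares a proof that \<open>M\<close> is nonzero\<close>
    define M where "M = dunkl_sphere_mass P k + \<bar>K\<bar> * (\<integral>x. w x \<partial>lborel)"
    have "\<bar>A - K * B h\<bar> \<le> 0"
    proof (rule field_le_epsilon)
      fix e :: real assume e: "e > 0"
      have "e / (\<bar>M\<bar> + 1) > 0" using e by simp
      from bound[OF this] have "\<bar>A - K * B h\<bar> \<le> e / (\<bar>M\<bar> + 1) * M" by (simp only: M_def)
      also have "\<dots> \<le> e / (\<bar>M\<bar> + 1) * (\<bar>M\<bar> + 1)" using e by (intro mult_left_mono) auto
      also have "\<dots> = e" by (simp add: add_nonneg_eq_0_iff)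
      finally show "\<bar>A - K * B h\<bar> \<le> 0 + e" by simp
    qed
    then show ?thesis by simp
  qed
  moreover have "t powr (2 - 2 * \<gamma> - real CARD('n)) *
      (LINT y:ball 0 t|lborel. h y * (t\<^sup>2 - (norm y)\<^sup>2) powr (\<gamma> - 1)) = B h"
    using ball_integral_rescale[OF \<open>h \<in> borel_measurable borel\<close> t, of \<gamma>] by (simp add: B_def w_def mult_ac)
  ultimately show ?thesis
    unfolding A_def[symmetric] K_def[symmetric] by (simp only: mult.assoc)
qed

end
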